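(* Let $v,v'\in\sigma$ and let $\omega=\phi(v)$, $\omega'=\phi(v')$. Let $\mathcal{J}\subset R_\sigma$ be an ideal and let $J:=\Psi^{-1}(\mathcal{J})\subset\mathbf{K}[y_1,\ldots,y_s]$. Then $$\mathrm{In}_v(\mathcal{J})=\mathrm{In}_{v'}(\mathcal{J})\quad\text{if and only if}\quad \mathrm{In}_\omega(J)=\mathrm{In}_{\omega'}(J).$$ In particular, the (closures in $\mathbf{R}^n$ of the) equivalence classes of the relation on $\sigma$ given by $v_1\sim v_2$ if and only if $\mathrm{In}_{v_1}(\mathcal{J})=\mathrm{In}_{v_2}(\mathcal{J})$ define a polyhedral fan which is a subdivision of $\sigma$ and which is obtained by intersecting the Groebner fan of $J$ with $\sigma$ (where $\sigma$ is identified with $\phi(\sigma)\subset\mathbf{R}_+^s$).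
   Context: $\mathbf{K}$ is a perfect field. $N\simeq\mathbf{Z}^n$ is a free abelian group of rank $n$, $M\simeq\mathbf{Z}^n$ is its dual lattice, $N_{\mathbf{R}}=N\otimes_{\mathbf{Z}}\mathbf{R}$ and $M_{\mathbf{R}}=M\otimes_{\mathbf{Z}}\mathbf{R}$, both identified with $\mathbf{R}^n$, and $\cdot$ denotes the scalar product. $\sigma\subset N_{\mathbf{R}}$ is a strongly convex rational polyhedral cone of dimension $n$, with dual cone $\sigma^\vee\subset M_{\mathbf{R}}$, and $R_\sigma=\mathbf{K}[\sigma^\vee\cap M]$. Let $\alpha^1,\ldots,\alpha^s$ be a minimal set of generators of the semigroup $\sigma^\vee\cap M$. Let $\Psi:\mathbf{K}[y_1,\ldots,y_s]\to R_\sigma$ be the surjective $\mathbf{K}$-algebra morphism with $\Psi(y_i)=\mathbf{x}^{\alpha^i}$, and let $\phi:\mathbf{R}^n\to\mathbf{R}^s$ be the injective linear map $\phi(v)=(v\cdot\alpha^1,\ldots,v\cdot\alpha^s)$, which satisfies $\phi(\sigma)\subset\mathbf{R}_+^s=\{\omega\in\mathbf{R}^s:\omega_i\geq0\}$. For $v\in\sigma$ and $0\neq f=\sum_\alpha a_\alpha\mathbf{x}^\alpha\in R_\sigma$ with support $\mathrm{Supp}(f)=\{\alpha:a_\alpha\neq 0\}$: $\nu_v(f)=\min\{v\cdot\alpha:\alpha\in\mathrm{Supp}(f)\}\in\mathbf{R}$ and $\mathrm{In}_v(f)=\sum_{\alpha\in\mathrm{Supp}(f),\ v\cdot\alpha=\nu_v(f)}a_\alpha\mathbf{x}^\alpha$;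 $\nu_v(0)=\infty$, $\mathrm{In}_v(0)=0$. For an ideal $\mathcal{J}\subset R_\sigma$, $\mathrm{In}_v(\mathcal{J})$ is the ideal of $R_\sigma$ generated by $\{\mathrm{In}_v(f):f\in\mathcal{J}\}$. For $\omega\in\mathbf{R}_+^s$, $h\in\mathbf{K}[y_1,\ldots,y_s]$ and an ideal $J\subset\mathbf{K}[y_1,\ldots,y_s]$, the objects $\nu_\omega(h)$, $\mathrm{In}_\omega(h)$, $\mathrm{In}_\omega(J)$ are defined in the same way (exponents $\gamma\in\mathbf{Z}_{\geq0}^s$, weight $\omega\cdot\gamma$). The Groebner fan of $J$ is the fan in $\mathbf{R}_+^s$ whose cones are the closures of the equivalence classes of the relation $\omega\sim\omega'$ if and only if $\mathrm{In}_\omega(J)=\mathrm{In}_{\omega'}(J)$ on $\mathbf{R}_+^s$.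
   Formalization: The "in particular" part assumes that the closures of the classes for J, with their nonempty faces, do form a fan, as the definition of the Groebner fan presupposes; this and the claim fail for some J, e.g. J=(y_3-1, y_1-y_2) with σ the orthant in R^3. *)

theory Defs
  imports
    "HOL-Analysis.Analysis"
    "HOL-Library.Poly_Mapping"
    "HOL-Computational_Algebra.Polynomial"
    "HOL-Algebra.Ideal"
begin

definition perfect_field :: "'k::field itself \<Rightarrow> bool"
  where "perfect_field _ \<longleftrightarrow> (\<forall>p :: 'k poly. irreducible p \<longrightarrow> coprime p (pderiv p))"


section \<open>Lattices and cones\<close>

text \<open>
  With bases chosen, \<open>N\<close> and \<open>M\<close> are \<open>int^'n\<close>, the real spaces \<open>N\<^sub>R\<close> and \<open>M\<^sub>R\<close> are
  \<open>real^'n\<close>, and the pairing is the inner product.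
\<close>

definition int_vec :: "int^'n \<Rightarrow> real^'n"
  where "int_vec a = (\<chi> i. real_of_int (a $ i))"

definition nat_vec :: "nat^'s \<Rightarrow> real^'s"
  where "nat_vec c = (\<chi> i. real (c $ i))"

definition rational_polyhedral_cone :: "(real^'n) set \<Rightarrow> bool"
  where "rational_polyhedral_cone \<sigma> \<longleftrightarrow>
    (\<exists>S :: (int^'n) set. finite S \<and> \<sigma> = convex_cone hull (int_vec ` S))"

definition strongly_convex :: "(real^'n) set \<Rightarrow> bool"
  where "strongly_convex \<sigma> \<longleftrightarrow> \<sigma> \<inter> uminus ` \<sigma> = {0}"

definition dual_cone :: "(real^'n) set \<Rightarrow> (real^'n) set"
  where "dual_cone \<sigma> = {u. \<forall>v\<in>\<sigma>. 0 \<le> v \<bullet> u}"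

definition dual_semigroup :: "(real^'n) set \<Rightarrow> (int^'n) set"
  where "dual_semigroup \<sigma> = {a. int_vec a \<in> dual_cone \<sigma>}"

text \<open>Semigroups have a neutral element, which generating sets need not contain.\<close>

definition submonoid_set :: "'m::comm_monoid_add set \<Rightarrow> bool"
  where "submonoid_set S \<longleftrightarrow> 0 \<in> S \<and> (\<forall>a\<in>S. \<forall>b\<in>S. a + b \<in> S)"

definition minimal_generators :: "'m::comm_monoid_add set \<Rightarrow> 'm set \<Rightarrow> bool"
  where "minimal_generators A S \<longleftrightarrow>
    submonoid_set hull A = S \<and> (\<forall>B. B \<subset> A \<longrightarrow> submonoid_set hull B \<noteq> S)"

definition nonneg_orthant :: "(real^'s) set"
  where "nonneg_orthant = {\<omega>. \<forall>i. 0 \<le> \<omega> $ i}"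

definition phi :: "('s::finite \<Rightarrow> int^'n) \<Rightarrow> real^'n \<Rightarrow> real^'s"
  where "phi \<alpha> v = (\<chi> i. v \<bullet> int_vec (\<alpha> i))"


section \<open>Semigroup algebras and initial ideals\<close>

text \<open>
  \<open>K[S]\<close> inside the ring of all finitely supported functions with convolution product.
  The polynomial ring \<open>K[y\<^sub>1,\<dots>,y\<^sub>s]\<close> is the case of \<open>UNIV :: (nat^'s) set\<close>, and \<open>R\<^sub>\<sigma>\<close> the case
  of \<open>dual_semigroup \<sigma>\<close>.
\<close>

definition semigroup_ring :: "'m::comm_monoid_add set \<Rightarrow> ('m \<Rightarrow>\<^sub>0 'k::field) ring"
  where "semigroup_ring S =
    \<lparr>carrier = {f. Poly_Mapping.keys f \<subseteq> S}, mult = (*), one = 1, zero = 0, add = (+)\<rparr>"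

text \<open>Below, \<open>w\<close> assigns to each exponent its weight. The infimum over the empty set is \<open>\<infinity>\<close>.\<close>

definition init_order :: "('m \<Rightarrow> real) \<Rightarrow> ('m \<Rightarrow>\<^sub>0 'k::field) \<Rightarrow> ereal"
  where "init_order w f = (INF a\<in>Poly_Mapping.keys f. ereal (w a))"

definition init_form :: "('m \<Rightarrow> real) \<Rightarrow> ('m \<Rightarrow>\<^sub>0 'k::field) \<Rightarrow> ('m \<Rightarrow>\<^sub>0 'k)"
  where "init_form w f =
    (\<Sum>a\<in>{a \<in> Poly_Mapping.keys f. ereal (w a) = init_order w f}.
       Poly_Mapping.single a (Poly_Mapping.lookup f a))"

definition init_ideal ::
    "'m::comm_monoid_add set \<Rightarrow> ('m \<Rightarrow> real) \<Rightarrow> ('m \<Rightarrow>\<^sub>0 'k::field) set \<Rightarrow> ('m \<Rightarrow>\<^sub>0 'k) set"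
  where "init_ideal S w I = genideal (semigroup_ring S) (init_form w ` I)"

definition In_toric ::
    "(real^'n) set \<Rightarrow> real^'n \<Rightarrow> (int^'n \<Rightarrow>\<^sub>0 'k::field) set \<Rightarrow> (int^'n \<Rightarrow>\<^sub>0 'k) set"
  where "In_toric \<sigma> v I = init_ideal (dual_semigroup \<sigma>) (\<lambda>a. v \<bullet> int_vec a) I"

definition In_poly ::
    "real^'s \<Rightarrow> (nat^'s \<Rightarrow>\<^sub>0 'k::field) set \<Rightarrow> (nat^'s \<Rightarrow>\<^sub>0 'k) set"
  where "In_poly \<omega> J = init_ideal UNIV (\<lambda>c. \<omega> \<bullet> nat_vec c) J"

definition exponent_map :: "('s::finite \<Rightarrow> int^'n) \<Rightarrow> nat^'s \<Rightarrow> int^'n"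
  where "exponent_map \<alpha> c = (\<Sum>i\<in>UNIV. int (c $ i) *s \<alpha> i)"

definition Psi :: "('s::finite \<Rightarrow> int^'n) \<Rightarrow> (nat^'s \<Rightarrow>\<^sub>0 'k::field) \<Rightarrow> (int^'n \<Rightarrow>\<^sub>0 'k)"
  where "Psi \<alpha> h = (\<Sum>c\<in>Poly_Mapping.keys h.
    Poly_Mapping.single (exponent_map \<alpha> c) (Poly_Mapping.lookup h c))"

text \<open>
  \<open>Psi \<alpha>\<close> is the morphism of \<open>K\<close>-algebras sending each variable \<open>y\<^sub>i\<close> to the monomial with
  exponent \<open>\<alpha> i\<close>.
\<close>

lemma exponent_map_add: "exponent_map \<alpha> (c + d) = exponent_map \<alpha> c + exponent_map \<alpha> d"
  by (simp add: exponent_map_def vector_sadd_rdistrib sum.distrib)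

lemma exponent_map_axis: "exponent_map \<alpha> (axis i 1) = \<alpha> i"
proof -
  have "exponent_map \<alpha> (axis i 1) = (\<Sum>j\<in>UNIV. if j = i then \<alpha> j else 0)"
    unfolding exponent_map_def by (rule sum.cong) (auto simp: axis_def)
  then show ?thesis by simp
qed

lemma Psi_superset:
  assumes "finite A" "Poly_Mapping.keys h \<subseteq> A"
  shows "Psi \<alpha> h =
    (\<Sum>c\<in>A. Poly_Mapping.single (exponent_map \<alpha> c) (Poly_Mapping.lookup h c))"
  unfolding Psi_def using assms
  by (intro sum.mono_neutral_left) (auto simp: in_keys_iff)

lemma Psi_single:
  "Psi \<alpha> (Poly_Mapping.single c a) = Poly_Mapping.single (exponent_map \<alpha> c) a"
  by (simp add: Psi_def)

lemma Psi_var: "Psi \<alpha> (Poly_Mapping.single (axis i 1) 1) = Poly_Mapping.single (\<alpha> i) 1"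
  unfolding Psi_single exponent_map_axis ..

lemma Psi_const: "Psi \<alpha> (Poly_Mapping.single 0 a) = Poly_Mapping.single 0 a"
proof -
  have "exponent_map \<alpha> 0 = 0"
    using exponent_map_add[of \<alpha> 0 0] by simp
  then show ?thesis by (simp add: Psi_single)
qed

lemma Psi_add: "Psi \<alpha> (g + h) = Psi \<alpha> g + Psi \<alpha> h"
proof -
  let ?A = "Poly_Mapping.keys g \<union> Poly_Mapping.keys h"
  have "Poly_Mapping.keys (g + h) \<subseteq> ?A" by (rule Poly_Mapping.keys_add)
  then show ?thesis
    by (simp add: Psi_superset[of ?A] lookup_add single_add sum.distrib)
qed

lemma Psi_sum: "Psi \<alpha> (sum f A) = (\<Sum>x\<in>A. Psi \<alpha> (f x))"
proof (induction A rule: infinite_finite_induct)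
  case (insert x A)
  then show ?case by (simp add: Psi_add)
qed (simp_all add: Psi_def)

lemma sum_single_keys:
  "(\<Sum>c\<in>Poly_Mapping.keys h. Poly_Mapping.single c (Poly_Mapping.lookup h c)) = h"
  by (rule poly_mapping_eqI)
     (auto simp: lookup_sum lookup_single when_def in_keys_iff)

lemma Psi_mult: "Psi \<alpha> (g * h) = Psi \<alpha> g * Psi \<alpha> h"
proof -
  let ?s = "\<lambda>h c. Poly_Mapping.single c (Poly_Mapping.lookup h c)"
  have "Psi \<alpha> (g * h) =
      Psi \<alpha> (\<Sum>c\<in>Poly_Mapping.keys g. \<Sum>d\<in>Poly_Mapping.keys h. ?s g c * ?s h d)"
    by (simp add: sum_product[symmetric] sum_single_keys)
  also have "\<dots> = Psi \<alpha> g * Psi \<alpha> h"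
    by (simp add: Psi_sum mult_single Psi_single exponent_map_add sum_product
        Psi_def[of \<alpha> g] Psi_def[of \<alpha> h])
  finally show ?thesis .
qed


section \<open>Fans\<close>

definition polyhedral_fan :: "'v::euclidean_space set set \<Rightarrow> bool"
  where "polyhedral_fan \<Sigma> \<longleftrightarrow>
    finite \<Sigma> \<and>
    (\<forall>\<tau>\<in>\<Sigma>. polyhedron \<tau> \<and> convex_cone \<tau>) \<and>
    (\<forall>\<tau>\<in>\<Sigma>. \<forall>F. F face_of \<tau> \<and> F \<noteq> {} \<longrightarrow> F \<in> \<Sigma>) \<and>
    (\<forall>\<tau>\<in>\<Sigma>. \<forall>\<tau>'\<in>\<Sigma>. (\<tau> \<inter> \<tau>') face_of \<tau> \<and> (\<tau> \<inter> \<tau>') face_of \<tau>')"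

definition subdivision_of :: "'v::euclidean_space set set \<Rightarrow> 'v set \<Rightarrow> bool"
  where "subdivision_of \<Sigma> \<sigma> \<longleftrightarrow> polyhedral_fan \<Sigma> \<and> \<Union>\<Sigma> = \<sigma>"

text \<open>
  The collection defined by the closures of the classes of the relation \<open>I v = I v'\<close> on \<open>X\<close>.
  The nonempty faces of the closures have to be added: for the zero ideal, for instance, all of
  \<open>X\<close> is a single class. Since a set is a face of itself only if it is convex, the closures
  are also listed separately.
\<close>

definition class_closures :: "('v::euclidean_space \<Rightarrow> 'i) \<Rightarrow> 'v set \<Rightarrow> 'v set set"
  where "class_closures I X =
    closure ` (X // {(v, v'). v \<in> X \<and> v' \<in> X \<and> I v = I v'})"

definition class_fan :: "('v::euclidean_space \<Rightarrow> 'i) \<Rightarrow> 'v set \<Rightarrow> 'v set set"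
  where "class_fan I X =
    class_closures I X \<union> {F. F \<noteq> {} \<and> (\<exists>C\<in>class_closures I X. F face_of C)}"

text \<open>
  Without further hypotheses on \<open>J\<close> this need not satisfy \<open>polyhedral_fan\<close>. For
  \<open>J = (y\<^sub>3 - 1, y\<^sub>1 - y\<^sub>2)\<close> all \<open>\<omega>\<close> with \<open>\<omega>\<^sub>3 > 0\<close> are equivalent, with initial ideal \<open>(1)\<close>, while on
  the facet \<open>\<omega>\<^sub>3 = 0\<close> of the orthant the signs of \<open>\<omega>\<^sub>1 - \<omega>\<^sub>2\<close> give three classes.
  The closures of two of these are cut out of the facet by \<open>\<omega>\<^sub>1 \<le> \<omega>\<^sub>2\<close> and \<open>\<omega>\<^sub>1 \<ge> \<omega>\<^sub>2\<close> and
  are not faces of the orthant, which is itself the closure of a class.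
\<close>

definition groebner_fan :: "(nat^'s \<Rightarrow>\<^sub>0 'k::field) set \<Rightarrow> (real^'s) set set"
  where "groebner_fan J = class_fan (\<lambda>\<omega>. In_poly \<omega> J) nonneg_orthant"

definition toric_groebner_fan ::
    "(real^'n) set \<Rightarrow> (int^'n \<Rightarrow>\<^sub>0 'k::field) set \<Rightarrow> (real^'n) set set"
  where "toric_groebner_fan \<sigma> I = class_fan (\<lambda>v. In_toric \<sigma> v I) \<sigma>"

end

theory Submission
  imports Defs "HOL-Library.List_Lexorder"
begin

text \<open>
Write \<open>\<omega> = phi \<alpha> v\<close>. The weight \<open>\<omega> \<bullet> c\<close> of a monomial of the polynomial ring equals the weight
\<open>v \<bullet> exponent_map \<alpha> c\<close> of its image, so \<open>Psi \<alpha>\<close> is a surjective homomorphism of graded rings onto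
\<open>R\<^sub>\<sigma>\<close>. Its kernel lies in \<open>J\<close> and is homogeneous, hence it lies in the initial ideal of \<open>J\<close>; and
each element of \<open>I\<close> has a lift to \<open>J\<close> with no term of smaller weight. Therefore the initial ideal of
\<open>J\<close> is the preimage of that of \<open>I\<close> (\<open>init_ideal_Psi_vimage\<close>), and as \<open>Psi \<alpha>\<close> is onto, each of the
two determines the other. This is the first claim.

For the second claim, \<open>phi \<alpha>\<close> identifies \<open>\<sigma>\<close> with the slice of the orthant by the linear space
\<open>range (phi \<alpha>)\<close> (\<open>phi_image_cone\<close>): because \<open>\<sigma>\<close> is rational and strongly convex, the integer points
of its dual cone are enough to cut it out. By the first claim the classes on \<open>\<sigma>\<close> are the slices of
the classes on the orthant. It remains to see that slicing commutes with taking closures and faces.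

For closures this is not a formality. A class could meet the slice only inside the relative boundary
of its closure, and nothing in the definition says which boundary points belong to the class. Two
facts about initial ideals settle this.

First, let \<open>W\<close> be the set of all \<open>u\<close> for which the initial ideal at \<open>\<omega>\<close> is homogeneous for the
weight \<open>u\<close>. It is a linear subspace, and every \<open>\<omega>'\<close> in the class of \<open>\<omega>\<close> lies in it, since the
initial ideal at \<open>\<omega>'\<close> is homogeneous for \<open>\<omega>'\<close>. A linear subspace is closed, so \<open>W\<close> contains the
closure of the class.

Second, for \<open>u\<close> in \<open>W\<close> the initial ideals at \<open>\<omega> + \<epsilon> u\<close> and at \<open>\<omega>\<close> agree for all small \<open>\<epsilon> > 0\<close>
(\<open>In_poly_locally_constant\<close>). This is where finiteness enters: \<open>J\<close> need not be homogeneous and the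
weights may vanish on some variables, so the usual division need not terminate. Bounding the total
degree of everything that occurs makes it terminate, and Dickson's lemma, applied to leading
exponents together with the slack in the degree bound, gives finitely many divisors that suffice.

Let \<open>F\<close> be a cone of the Groebner fan. If \<open>z\<close> is in its relative interior, then the fan property puts
\<open>F\<close> inside the closure of the class of \<open>z\<close>, so all directions within \<open>F\<close> belong to the space \<open>W\<close> of
\<open>z\<close>. Hence the initial ideal is locally constant along segments in the relative interior of \<open>F\<close>, and
so it is constant there (\<open>constant_on_rel_interior\<close>). With this the closure of a sliced class is the
slice of the closure (\<open>closure_slice_class\<close>), and the rest is the geometry of faces.
\<close>

section \<open>Homogeneous components and leading forms\<close>

definition component :: "'m set \<Rightarrow> ('m \<Rightarrow>\<^sub>0 'k::comm_monoid_add) \<Rightarrow> ('m \<Rightarrow>\<^sub>0 'k)"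
  where "component A f = (\<Sum>a\<in>Poly_Mapping.keys f \<inter> A. Poly_Mapping.single a (Poly_Mapping.lookup f a))"

lemma lookup_component:
  "Poly_Mapping.lookup (component A f) a = (if a \<in> A then Poly_Mapping.lookup f a else 0)"
proof -
  have "Poly_Mapping.lookup (component A f) a
      = (\<Sum>b\<in>Poly_Mapping.keys f \<inter> A. if b = a then Poly_Mapping.lookup f a else 0)"
    unfolding component_def by (auto simp: lookup_sum lookup_single when_def intro!: sum.cong)
  also have "\<dots> = (if a \<in> A then Poly_Mapping.lookup f a else 0)"
    by (auto simp: in_keys_iff)
  finally show ?thesis .
qed

lemma keys_component: "Poly_Mapping.keys (component A f) = Poly_Mapping.keys f \<inter> A"
  by (auto simp: in_keys_iff lookup_component split: if_splits)

lemma component_0 [simp]: "component A 0 = 0"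
  by (rule poly_mapping_eqI) (simp add: lookup_component)

lemma component_add: "component A (f + g) = component A f + component A g"
  by (rule poly_mapping_eqI) (simp add: lookup_component lookup_add)

lemma component_sum: "component A (sum f B) = (\<Sum>b\<in>B. component A (f b))"
  by (induction B rule: infinite_finite_induct) (simp_all add: component_add)

lemma component_component: "component A (component B f) = component (A \<inter> B) f"
  by (rule poly_mapping_eqI) (simp add: lookup_component)

lemma component_cong:
  "(\<And>a. a \<in> Poly_Mapping.keys f \<Longrightarrow> a \<in> A \<longleftrightarrow> a \<in> B) \<Longrightarrow> component A f = component B f"
  by (rule poly_mapping_eqI) (auto simp: lookup_component in_keys_iff)

lemma component_id: "Poly_Mapping.keys f \<subseteq> A \<Longrightarrow> component A f = f"
  by (rule poly_mapping_eqI) (auto simp: lookup_component in_keys_iff)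

lemma component_eq_0: "Poly_Mapping.keys f \<inter> A = {} \<Longrightarrow> component A f = 0"
  by (rule poly_mapping_eqI) (auto simp: lookup_component in_keys_iff)

lemma component_single:
  "component A (Poly_Mapping.single a k) = (if a \<in> A then Poly_Mapping.single a k else 0)"
  by (rule poly_mapping_eqI) (auto simp: lookup_component lookup_single when_def)

lemma single_times_eq_sum:
  fixes f :: "'m::comm_monoid_add \<Rightarrow>\<^sub>0 'k::comm_ring"
  shows "Poly_Mapping.single c k * f =
    (\<Sum>a\<in>Poly_Mapping.keys f. Poly_Mapping.single (c + a) (k * Poly_Mapping.lookup f a))"
proof -
  have "f = component UNIV f" by (simp add: component_id)
  then have "Poly_Mapping.single c k * f = Poly_Mapping.single c k * component UNIV f"
    by simp
  also have "\<dots> = (\<Sum>a\<in>Poly_Mapping.keys f. Poly_Mapping.single (c + a) (k * Poly_Mapping.lookup f a))"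
    unfolding component_def by (simp add: sum_distrib_left mult_single)
  finally show ?thesis .
qed

lemma keys_single_times:
  fixes f :: "'m::comm_monoid_add \<Rightarrow>\<^sub>0 'k::comm_ring_1"
  shows "Poly_Mapping.keys (Poly_Mapping.single c k * f) \<subseteq> (\<lambda>a. c + a) ` Poly_Mapping.keys f"
  using keys_mult[of "Poly_Mapping.single c k" f] by (auto split: if_splits)

lemma component_single_times:
  fixes f :: "'m::comm_monoid_add \<Rightarrow>\<^sub>0 'k::comm_ring_1"
  shows "component A (Poly_Mapping.single c k * f) =
    Poly_Mapping.single c k * component {a. c + a \<in> A} f"
proof -
  have "component A (Poly_Mapping.single c k * f) =
      (\<Sum>a\<in>Poly_Mapping.keys f. if c + a \<in> A then Poly_Mapping.single (c + a) (k * Poly_Mapping.lookup f a) else 0)"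
    by (simp add: single_times_eq_sum[of c k f] component_sum component_single)
  also have "\<dots> = (\<Sum>a\<in>Poly_Mapping.keys f \<inter> {a. c + a \<in> A}.
      Poly_Mapping.single (c + a) (k * Poly_Mapping.lookup f a))"
    by (simp add: sum.inter_restrict)
  also have "\<dots> = Poly_Mapping.single c k * component {a. c + a \<in> A} f"
    by (simp add: component_def sum_distrib_left mult_single)
  finally show ?thesis .
qed

lemma sum_components:
  "(\<Sum>e\<in>w ` Poly_Mapping.keys f. component {a. w a = e} f) = f"
proof (rule poly_mapping_eqI)
  fix a
  have "Poly_Mapping.lookup (\<Sum>e\<in>w ` Poly_Mapping.keys f. component {a. w a = e} f) a
      = (\<Sum>e\<in>w ` Poly_Mapping.keys f. if w a = e then Poly_Mapping.lookup f a else 0)"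
    by (simp add: lookup_sum lookup_component)
  also have "\<dots> = Poly_Mapping.lookup f a"
    by (auto simp: in_keys_iff)
  finally show "Poly_Mapping.lookup (\<Sum>e\<in>w ` Poly_Mapping.keys f. component {a. w a = e} f) a =
    Poly_Mapping.lookup f a" .
qed

text \<open>
\<open>lead_form\<close> is \<open>init_form\<close> for weights in any linear order. Besides real weights, lexicographic
weights with values in lists of reals are needed below.
\<close>

definition lead_form :: "('m \<Rightarrow> 'w::linorder) \<Rightarrow> ('m \<Rightarrow>\<^sub>0 'k::comm_monoid_add) \<Rightarrow> ('m \<Rightarrow>\<^sub>0 'k)"
  where "lead_form w f = component {a. \<forall>b\<in>Poly_Mapping.keys f. w a \<le> w b} f"

lemma lead_form_0 [simp]: "lead_form w 0 = 0"
  by (simp add: lead_form_def)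

lemma lead_form_eq_component:
  assumes "a \<in> Poly_Mapping.keys f" "\<And>b. b \<in> Poly_Mapping.keys f \<Longrightarrow> w a \<le> w b"
  shows "lead_form w f = component {b. w b = w a} f"
  unfolding lead_form_def using assms by (intro component_cong) (auto intro: antisym)

lemma ex_min_key:
  fixes w :: "'m \<Rightarrow> 'w::linorder"
  assumes "f \<noteq> 0"
  shows "\<exists>a\<in>Poly_Mapping.keys f. \<forall>b\<in>Poly_Mapping.keys f. w a \<le> w b"
proof -
  have ne: "w ` Poly_Mapping.keys f \<noteq> {}" using assms by simp
  then have "Min (w ` Poly_Mapping.keys f) \<in> w ` Poly_Mapping.keys f"
    by (intro Min_in) auto
  then obtain a where "a \<in> Poly_Mapping.keys f" "w a = Min (w ` Poly_Mapping.keys f)" by auto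
  then show ?thesis by (intro bexI[of _ a]) auto
qed

text \<open>
Statements about leading forms are mostly used in this shape: with a mere lower bound \<open>e\<close> on the
weights instead of the minimum, the component of weight \<open>e\<close> is additive in \<open>f\<close>, which the leading
form is not.
\<close>

lemma component_bound_cases:
  fixes w :: "'m \<Rightarrow> 'w::linorder"
  assumes "\<And>a. a \<in> Poly_Mapping.keys f \<Longrightarrow> e \<le> w a"
  shows "component {a. w a = e} f = 0 \<or> component {a. w a = e} f = lead_form w f"
proof (cases "\<exists>a\<in>Poly_Mapping.keys f. w a = e")
  case True
  then obtain a where a: "a \<in> Poly_Mapping.keys f" "w a = e" by blast
  then have "lead_form w f = component {b. w b = e} f"
    using lead_form_eq_component[of a f w] assms by auto
  then show ?thesis by simp
next
  case False
  then show ?thesis by (intro disjI1 component_eq_0) auto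
qed

lemma init_form_eq_lead_form: "init_form w f = lead_form w f"
proof (cases "f = 0")
  case True
  then show ?thesis by (simp add: init_form_def)
next
  case False
  then obtain a where a: "a \<in> Poly_Mapping.keys f" and le: "\<And>b. b \<in> Poly_Mapping.keys f \<Longrightarrow> w a \<le> w b"
    using ex_min_key[of f w] by blast
  have "init_order w f = ereal (w a)"
    unfolding init_order_def by (rule antisym) (auto intro!: INF_lower INF_greatest a le)
  then have "init_form w f = component {b. w b = w a} f"
    unfolding init_form_def component_def by (intro sum.cong) auto
  with lead_form_eq_component[of a f w, OF a] le show ?thesis by simp
qed


section \<open>Ideals of a semigroup ring\<close>

text \<open>
Closure under multiplication by monomials is easier to check than closure under multiplication by
all ring elements, and it amounts to the same because every element is a sum of monomials.
\<close>

definition semigroup_ideal :: "'m::comm_monoid_add set \<Rightarrow> ('m \<Rightarrow>\<^sub>0 'k::field) set \<Rightarrow> bool"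
  where "semigroup_ideal S A \<longleftrightarrow>
    (\<forall>f\<in>A. Poly_Mapping.keys f \<subseteq> S) \<and> 0 \<in> A \<and> (\<forall>f\<in>A. \<forall>g\<in>A. f + g \<in> A) \<and>
    (\<forall>f\<in>A. \<forall>c\<in>S. \<forall>k. Poly_Mapping.single c k * f \<in> A)"

lemma semigroup_idealI:
  assumes "\<And>f. f \<in> A \<Longrightarrow> Poly_Mapping.keys f \<subseteq> S" "0 \<in> A"
    "\<And>f g. f \<in> A \<Longrightarrow> g \<in> A \<Longrightarrow> f + g \<in> A"
    "\<And>f c k. f \<in> A \<Longrightarrow> c \<in> S \<Longrightarrow> Poly_Mapping.single c k * f \<in> A"
  shows "semigroup_ideal S A"
  using assms by (auto simp: semigroup_ideal_def)

context
  fixes S :: "'m::comm_monoid_add set" and A :: "('m \<Rightarrow>\<^sub>0 'k::field) set"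
  assumes A: "semigroup_ideal S A"
begin

lemma semigroup_ideal_keys: "f \<in> A \<Longrightarrow> Poly_Mapping.keys f \<subseteq> S"
  and semigroup_ideal_0: "0 \<in> A"
  and semigroup_ideal_add: "f \<in> A \<Longrightarrow> g \<in> A \<Longrightarrow> f + g \<in> A"
  and semigroup_ideal_single_times: "f \<in> A \<Longrightarrow> c \<in> S \<Longrightarrow> Poly_Mapping.single c k * f \<in> A"
  using A by (auto simp: semigroup_ideal_def)

lemma semigroup_ideal_sum: "(\<And>b. b \<in> B \<Longrightarrow> f b \<in> A) \<Longrightarrow> sum f B \<in> A"
  by (induction B rule: infinite_finite_induct) (auto intro: semigroup_ideal_0 semigroup_ideal_add)

lemma semigroup_ideal_times:
  assumes "f \<in> A" "Poly_Mapping.keys g \<subseteq> S"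
  shows "g * f \<in> A"
proof -
  have "g * f = (\<Sum>c\<in>Poly_Mapping.keys g. Poly_Mapping.single c (Poly_Mapping.lookup g c) * f)"
    by (simp add: sum_distrib_right[symmetric] sum_single_keys)
  then show ?thesis
    using assms by (auto intro!: semigroup_ideal_sum semigroup_ideal_single_times)
qed

lemma semigroup_ideal_uminus:
  assumes "0 \<in> S" "f \<in> A"
  shows "- f \<in> A"
proof -
  have "Poly_Mapping.single 0 (- 1) * f = - f"
    by (simp add: single_uminus)
  then show ?thesis using semigroup_ideal_single_times[OF assms(2,1), of "-1"] by simp
qed

lemma semigroup_ideal_diff: "0 \<in> S \<Longrightarrow> f \<in> A \<Longrightarrow> g \<in> A \<Longrightarrow> f - g \<in> A"
  using semigroup_ideal_add[of f "- g"] semigroup_ideal_uminus[of g] by simp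

end

lemma ring_semigroup_ring:
  fixes S :: "'m::comm_monoid_add set"
  assumes S: "submonoid_set S"
  shows "ring (semigroup_ring S :: ('m \<Rightarrow>\<^sub>0 'k::field) ring)"
proof (rule ringI)
  let ?R = "semigroup_ring S :: ('m \<Rightarrow>\<^sub>0 'k) ring"
  have keys_times: "Poly_Mapping.keys (f * g) \<subseteq> S"
    if "Poly_Mapping.keys f \<subseteq> S" "Poly_Mapping.keys g \<subseteq> S" for f g :: "'m \<Rightarrow>\<^sub>0 'k"
  proof
    fix c assume "c \<in> Poly_Mapping.keys (f * g)"
    then obtain a b where "c = a + b" "a \<in> Poly_Mapping.keys f" "b \<in> Poly_Mapping.keys g"
      using keys_mult[of f g] by auto
    then show "c \<in> S" using that S by (auto simp: submonoid_set_def)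
  qed
  show "abelian_group ?R"
  proof (rule abelian_groupI)
    fix f assume f: "f \<in> carrier ?R"
    show "\<exists>g\<in>carrier ?R. g \<oplus>\<^bsub>?R\<^esub> f = \<zero>\<^bsub>?R\<^esub>"
      using f by (intro bexI[of _ "- f"]) (simp_all add: semigroup_ring_def)
  next
    fix f g assume "f \<in> carrier ?R" "g \<in> carrier ?R"
    then show "f \<oplus>\<^bsub>?R\<^esub> g \<in> carrier ?R"
      using Poly_Mapping.keys_add[of f g] by (auto simp: semigroup_ring_def)
  qed (simp_all add: semigroup_ring_def add_ac)
  show "Group.monoid ?R"
  proof (rule Group.monoidI)
    show "\<one>\<^bsub>?R\<^esub> \<in> carrier ?R"
      using S by (auto simp: semigroup_ring_def submonoid_set_def)
    show "f \<otimes>\<^bsub>?R\<^esub> g \<in> carrier ?R" if "f \<in> carrier ?R" "g \<in> carrier ?R" for f g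
      using that keys_times[of f g] by (simp add: semigroup_ring_def)
  qed (simp_all add: semigroup_ring_def mult.assoc)
qed (simp_all add: semigroup_ring_def algebra_simps)

lemma ideal_semigroup_ring_iff:
  fixes S :: "'m::comm_monoid_add set" and A :: "('m \<Rightarrow>\<^sub>0 'k::field) set"
  assumes S: "submonoid_set S"
  shows "ideal A (semigroup_ring S) \<longleftrightarrow> semigroup_ideal S A"
proof
  assume "ideal A (semigroup_ring S)"
  then interpret ideal A "semigroup_ring S" .
  show "semigroup_ideal S A"
  proof (rule semigroup_idealI)
    show "Poly_Mapping.keys f \<subseteq> S" if "f \<in> A" for f
      using a_subset that by (auto simp: semigroup_ring_def)
    show "0 \<in> A" using additive_subgroup.zero_closed[OF additive_subgroup_axioms] by (simp add: semigroup_ring_def)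
    show "f + g \<in> A" if "f \<in> A" "g \<in> A" for f g
      using additive_subgroup.a_closed[OF additive_subgroup_axioms that] by (simp add: semigroup_ring_def)
    show "Poly_Mapping.single c k * f \<in> A" if "f \<in> A" "c \<in> S" for f c k
      using I_l_closed[OF that(1), of "Poly_Mapping.single c k"] that
      by (simp add: semigroup_ring_def)
  qed
next
  assume A: "semigroup_ideal S A"
  let ?R = "semigroup_ring S :: ('m \<Rightarrow>\<^sub>0 'k) ring"
  interpret R: ring ?R using ring_semigroup_ring[OF S] .
  have 0: "0 \<in> S" using S by (simp add: submonoid_set_def)
  show "ideal A ?R"
  proof (rule idealI)
    show "ring ?R" ..
    show "subgroup A (add_monoid ?R)"
    proof (rule R.add.subgroupI)
      show "A \<subseteq> carrier ?R" using semigroup_ideal_keys[OF A] by (auto simp: semigroup_ring_def)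
      show "A \<noteq> {}" using semigroup_ideal_0[OF A] by auto
      show "\<ominus>\<^bsub>?R\<^esub> f \<in> A" if "f \<in> A" for f
      proof -
        have "f \<in> carrier ?R" "- f \<in> carrier ?R"
          using that semigroup_ideal_keys[OF A] by (auto simp: semigroup_ring_def)
        then have "\<ominus>\<^bsub>?R\<^esub> f = - f"
          by (intro R.minus_equality) (auto simp: semigroup_ring_def)
        then show ?thesis using semigroup_ideal_uminus[OF A 0 that] by simp
      qed
    qed (use semigroup_ideal_add[OF A] in \<open>auto simp: semigroup_ring_def\<close>)
    show "x \<otimes>\<^bsub>?R\<^esub> a \<in> A" if "a \<in> A" "x \<in> carrier ?R" for a x
      using semigroup_ideal_times[OF A, of a x] that by (simp add: semigroup_ring_def)
    show "a \<otimes>\<^bsub>?R\<^esub> x \<in> A" if "a \<in> A" "x \<in> carrier ?R" for a x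
      using semigroup_ideal_times[OF A, of a x] that by (simp add: semigroup_ring_def mult.commute)
  qed
qed

lemma keys_lead_form_subset: "Poly_Mapping.keys (lead_form w f) \<subseteq> Poly_Mapping.keys f"
  by (simp add: lead_form_def keys_component)

lemma
  fixes S :: "'m::comm_monoid_add set" and A :: "('m \<Rightarrow>\<^sub>0 'k::field) set"
  assumes S: "submonoid_set S" and A: "\<And>f. f \<in> A \<Longrightarrow> Poly_Mapping.keys f \<subseteq> S"
  shows semigroup_ideal_init_ideal: "semigroup_ideal S (init_ideal S w A)"
    and lead_form_in_init_ideal: "f \<in> A \<Longrightarrow> lead_form w f \<in> init_ideal S w A"
    and init_ideal_least:
      "semigroup_ideal S B \<Longrightarrow> (\<And>f. f \<in> A \<Longrightarrow> lead_form w f \<in> B) \<Longrightarrow> init_ideal S w A \<subseteq> B"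
proof -
  let ?R = "semigroup_ring S :: ('m \<Rightarrow>\<^sub>0 'k) ring"
  interpret R: ring ?R using ring_semigroup_ring[OF S] .
  have sub: "init_form w ` A \<subseteq> carrier ?R"
    using A keys_lead_form_subset[of w]
    by (fastforce simp: semigroup_ring_def init_form_eq_lead_form)
  show "semigroup_ideal S (init_ideal S w A)"
    using R.genideal_ideal[OF sub] by (simp add: ideal_semigroup_ring_iff[OF S] init_ideal_def)
  show "f \<in> A \<Longrightarrow> lead_form w f \<in> init_ideal S w A"
    using R.genideal_self[OF sub] by (auto simp: init_ideal_def init_form_eq_lead_form)
  show "semigroup_ideal S B \<Longrightarrow> (\<And>f. f \<in> A \<Longrightarrow> lead_form w f \<in> B) \<Longrightarrow> init_ideal S w A \<subseteq> B"
    unfolding init_ideal_def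
    by (intro R.genideal_minimal) (auto simp: ideal_semigroup_ring_iff[OF S] init_form_eq_lead_form)
qed

lemma component_in_init_ideal:
  fixes A :: "('m::comm_monoid_add \<Rightarrow>\<^sub>0 'k::field) set"
  assumes "submonoid_set S" "\<And>f. f \<in> A \<Longrightarrow> Poly_Mapping.keys f \<subseteq> S"
    and "f \<in> A" "\<And>a. a \<in> Poly_Mapping.keys f \<Longrightarrow> e \<le> w a"
  shows "component {a. w a = e} f \<in> init_ideal S w A"
  using component_bound_cases[of f e w] assms
    semigroup_ideal_0[OF semigroup_ideal_init_ideal[OF assms(1,2)], of A w]
    lead_form_in_init_ideal[OF assms(1,2), of A f w]
  by auto

section \<open>Initial ideals along the presentation\<close>

lemma submonoid_set_UNIV: "submonoid_set UNIV"
  by (simp add: submonoid_set_def)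

lemma exponent_map_0: "exponent_map \<alpha> 0 = 0"
  using exponent_map_add[of \<alpha> 0 0] by simp

lemma submonoid_set_range_exponent_map: "submonoid_set (range (exponent_map \<alpha>))"
  unfolding submonoid_set_def
proof (intro conjI ballI)
  show "0 \<in> range (exponent_map \<alpha>)" by (rule range_eqI[of _ _ 0]) (simp add: exponent_map_0)
  fix a b assume "a \<in> range (exponent_map \<alpha>)" "b \<in> range (exponent_map \<alpha>)"
  then show "a + b \<in> range (exponent_map \<alpha>)"
    by (auto simp: exponent_map_add[symmetric])
qed

lemma submonoid_set_sum:
  assumes S: "submonoid_set S" and f: "\<And>b. b \<in> B \<Longrightarrow> f b \<in> S"
  shows "sum f B \<in> S"
  using f by (induction B rule: infinite_finite_induct) (use S in \<open>auto simp: submonoid_set_def\<close>)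

text \<open>
The exponents of the monomials in the image of \<open>Psi \<alpha>\<close> form the monoid that the \<open>\<alpha> i\<close> generate.
For generators of \<open>dual_semigroup \<sigma>\<close> this makes \<open>Psi \<alpha>\<close> surjective onto \<open>R\<^sub>\<sigma>\<close>.
\<close>

lemma range_exponent_map:
  fixes \<alpha> :: "'s::finite \<Rightarrow> int^'n"
  shows "range (exponent_map \<alpha>) = submonoid_set hull (range \<alpha>)"
proof (rule antisym)
  let ?H = "submonoid_set hull (range \<alpha>)"
  have H: "submonoid_set ?H"
    by (rule hull_in) (auto simp: submonoid_set_def)
  have "exponent_map \<alpha> c \<in> ?H" for c
  proof -
    have "int k *s \<alpha> i \<in> ?H" for k i
    proof -
      have "int k *s \<alpha> i = (\<Sum>j<k. \<alpha> i)"
        by (induction k) (simp_all add: vector_sadd_rdistrib add.commute del: sum_constant)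
      moreover have "\<alpha> i \<in> ?H" by (simp add: hull_inc)
      ultimately show ?thesis using submonoid_set_sum[OF H, of "{..<k}" "\<lambda>_. \<alpha> i"] by simp
    qed
    then show ?thesis unfolding exponent_map_def by (intro submonoid_set_sum[OF H])
  qed
  then show "range (exponent_map \<alpha>) \<subseteq> ?H" by blast
  show "?H \<subseteq> range (exponent_map \<alpha>)"
    by (rule hull_minimal)
      (auto simp: submonoid_set_range_exponent_map, metis exponent_map_axis rangeI)
qed

lemma Psi_0 [simp]: "Psi \<alpha> 0 = 0"
  by (simp add: Psi_def)

lemma Psi_diff: "Psi \<alpha> (g - h) = Psi \<alpha> g - Psi \<alpha> h"
  using Psi_add[of \<alpha> "g - h" h] by (simp add: algebra_simps)

lemma component_Psi:
  "component A (Psi \<alpha> h) = Psi \<alpha> (component {c. exponent_map \<alpha> c \<in> A} h)"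
  by (auto simp: Psi_def[of \<alpha> h] component_def[of _ h] Psi_sum Psi_single component_sum
      component_single sum.inter_restrict intro!: sum.cong)

lemma keys_Psi: "Poly_Mapping.keys (Psi \<alpha> h) \<subseteq> exponent_map \<alpha> ` Poly_Mapping.keys h"
proof
  fix a assume a: "a \<in> Poly_Mapping.keys (Psi \<alpha> h)"
  show "a \<in> exponent_map \<alpha> ` Poly_Mapping.keys h"
  proof (rule ccontr)
    assume "a \<notin> exponent_map \<alpha> ` Poly_Mapping.keys h"
    then have "component {c. exponent_map \<alpha> c \<in> {a}} h = 0"
      by (intro component_eq_0) auto
    then have "component {a} (Psi \<alpha> h) = 0" unfolding component_Psi by simp
    moreover have "a \<in> Poly_Mapping.keys (component {a} (Psi \<alpha> h))"
      using a by (simp add: keys_component)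
    ultimately show False by simp
  qed
qed

text \<open>
Choosing one monomial above each term of \<open>f\<close> avoids spurious terms that cancel under \<open>Psi\<close>. Such
terms could have a smaller weight than \<open>f\<close>, and then the leading form of the lift would not lie above
that of \<open>f\<close>.
\<close>

lemma Psi_lift:
  assumes "Poly_Mapping.keys f \<subseteq> range (exponent_map \<alpha>)"
  obtains h where "Psi \<alpha> h = f" "exponent_map \<alpha> ` Poly_Mapping.keys h \<subseteq> Poly_Mapping.keys f"
proof -
  define s where "s = inv_into UNIV (exponent_map \<alpha>)"
  have s: "exponent_map \<alpha> (s a) = a" if "a \<in> Poly_Mapping.keys f" for a
    unfolding s_def using that assms by (intro f_inv_into_f) auto
  define h where "h = (\<Sum>a\<in>Poly_Mapping.keys f. Poly_Mapping.single (s a) (Poly_Mapping.lookup f a))"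
  have "Psi \<alpha> h = (\<Sum>a\<in>Poly_Mapping.keys f. Poly_Mapping.single a (Poly_Mapping.lookup f a))"
    by (simp add: h_def Psi_sum Psi_single s)
  then have 1: "Psi \<alpha> h = f" by (simp add: sum_single_keys)
  have "Poly_Mapping.keys h \<subseteq> s ` Poly_Mapping.keys f"
  proof
    fix c assume c: "c \<in> Poly_Mapping.keys h"
    show "c \<in> s ` Poly_Mapping.keys f"
    proof (rule ccontr)
      assume "c \<notin> s ` Poly_Mapping.keys f"
      then have "Poly_Mapping.lookup h c = 0"
        unfolding h_def lookup_sum by (intro sum.neutral) (auto simp: lookup_single when_def)
      with c show False by (simp add: in_keys_iff)
    qed
  qed
  then have "exponent_map \<alpha> ` Poly_Mapping.keys h \<subseteq> Poly_Mapping.keys f"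
    using s by force
  with 1 show ?thesis by (rule that)
qed

context
  fixes \<alpha> :: "'s::finite \<Rightarrow> int^'n" and S :: "(int^'n) set" and I :: "(int^'n \<Rightarrow>\<^sub>0 'k::field) set"
  assumes S: "S = range (exponent_map \<alpha>)" and I: "semigroup_ideal S I"
begin

lemma submonoid_S: "submonoid_set S"
  unfolding S by (rule submonoid_set_range_exponent_map)

lemma semigroup_ideal_Psi_vimage: "semigroup_ideal UNIV (Psi \<alpha> -` I)"
proof (rule semigroup_idealI)
  fix f c k assume "f \<in> Psi \<alpha> -` I"
  then show "Poly_Mapping.single c k * f \<in> Psi \<alpha> -` I"
    using semigroup_ideal_single_times[OF I, of "Psi \<alpha> f" "exponent_map \<alpha> c" k] S
    by (simp add: Psi_mult Psi_single)
qed (auto simp: Psi_add semigroup_ideal_0[OF I] semigroup_ideal_add[OF I])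

text \<open>
One inclusion holds because \<open>Psi\<close> maps a leading form to a leading form or to zero. For the other,
weight-preserving lifts show that \<open>Psi\<close> maps the initial ideal of the preimage of \<open>I\<close> onto that of
\<open>I\<close>, so what is left is the kernel of \<open>Psi\<close>.
\<close>

lemma init_ideal_Psi_vimage:
  fixes w :: "int^'n \<Rightarrow> real"
  shows "init_ideal UNIV (\<lambda>c. w (exponent_map \<alpha> c)) (Psi \<alpha> -` I) = Psi \<alpha> -` init_ideal S w I"
    (is "?L = ?R")
    and init_ideal_subset_Psi_image:
      "init_ideal S w I \<subseteq> Psi \<alpha> ` init_ideal UNIV (\<lambda>c. w (exponent_map \<alpha> c)) (Psi \<alpha> -` I)"
proof -
  let ?w = "\<lambda>c. w (exponent_map \<alpha> c)" and ?J = "Psi \<alpha> -` I"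
  have keysI: "\<And>f. f \<in> I \<Longrightarrow> Poly_Mapping.keys f \<subseteq> S"
    by (rule semigroup_ideal_keys[OF I])
  have keysJ: "\<And>h. h \<in> ?J \<Longrightarrow> Poly_Mapping.keys h \<subseteq> UNIV" by simp
  note L_ideal = semigroup_ideal_init_ideal[OF submonoid_set_UNIV keysJ, of ?J ?w, simplified]
  note R_ideal = semigroup_ideal_init_ideal[OF submonoid_S keysI, of I w, simplified]
  have comp: "component {a. w a = e} (Psi \<alpha> h) = Psi \<alpha> (component {c. ?w c = e} h)" for e h
    by (simp add: component_Psi)

  have LR: "?L \<subseteq> ?R"
  proof (rule init_ideal_least[OF submonoid_set_UNIV keysJ])
    show "semigroup_ideal UNIV ?R"
    proof (rule semigroup_idealI)
      fix f c k assume "f \<in> ?R"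
      then show "Poly_Mapping.single c k * f \<in> ?R"
        using semigroup_ideal_single_times[OF R_ideal, of "Psi \<alpha> f" "exponent_map \<alpha> c" k] S
        by (simp add: Psi_mult Psi_single)
    qed (auto simp: Psi_add semigroup_ideal_0[OF R_ideal] semigroup_ideal_add[OF R_ideal])
    fix h assume h: "h \<in> ?J"
    show "lead_form ?w h \<in> ?R"
    proof (cases "h = 0")
      case True
      then show ?thesis using semigroup_ideal_0[OF R_ideal] by simp
    next
      case False
      then obtain c where c: "c \<in> Poly_Mapping.keys h" "\<And>d. d \<in> Poly_Mapping.keys h \<Longrightarrow> ?w c \<le> ?w d"
        using ex_min_key[of h ?w] by blast
      have "\<And>a. a \<in> Poly_Mapping.keys (Psi \<alpha> h) \<Longrightarrow> ?w c \<le> w a"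
        using keys_Psi[of \<alpha> h] c(2) by auto
      then have "component {a. w a = ?w c} (Psi \<alpha> h) \<in> init_ideal S w I"
        using h by (intro component_in_init_ideal[OF submonoid_S keysI]) auto
      then show ?thesis
        using lead_form_eq_component[of c h ?w] c by (simp add: comp)
    qed
  qed simp

  \<comment> \<open>The components of an element of the kernel are again in the kernel, hence in the ideal, and each
      is its own leading form.\<close>
  have kernel: "h \<in> ?L" if "Psi \<alpha> h = 0" for h :: "nat^'s \<Rightarrow>\<^sub>0 'k"
  proof -
    have "component {c. ?w c = e} h \<in> ?L" for e
    proof -
      have "Psi \<alpha> (component {c. ?w c = e} h) = 0"
        using that comp[of e h] by simp
      then have "component {c. ?w c = e} h \<in> ?J"
        using semigroup_ideal_0[OF I] by simp
      from component_in_init_ideal[OF submonoid_set_UNIV keysJ this, of e ?w]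
      show ?thesis by (simp add: keys_component component_component)
    qed
    then have "(\<Sum>e\<in>?w ` Poly_Mapping.keys h. component {c. ?w c = e} h) \<in> ?L"
      by (intro semigroup_ideal_sum[OF L_ideal])
    then show ?thesis by (simp only: sum_components)
  qed

  show image: "init_ideal S w I \<subseteq> Psi \<alpha> ` ?L"
  proof (rule init_ideal_least[OF submonoid_S keysI])
    show "semigroup_ideal S (Psi \<alpha> ` ?L)"
    proof (rule semigroup_idealI)
      fix f assume "f \<in> Psi \<alpha> ` ?L"
      then show "Poly_Mapping.keys f \<subseteq> S" using keys_Psi[of \<alpha>] S by blast
    next
      show "0 \<in> Psi \<alpha> ` ?L" using semigroup_ideal_0[OF L_ideal] by (metis Psi_0 imageI)
    next
      fix f g assume "f \<in> Psi \<alpha> ` ?L" "g \<in> Psi \<alpha> ` ?L"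
      then show "f + g \<in> Psi \<alpha> ` ?L"
        using semigroup_ideal_add[OF L_ideal] by (auto simp: Psi_add[symmetric])
    next
      fix f a k assume "f \<in> Psi \<alpha> ` ?L" "a \<in> S"
      then obtain h c where "h \<in> ?L" "f = Psi \<alpha> h" "a = exponent_map \<alpha> c" using S by auto
      then show "Poly_Mapping.single a k * f \<in> Psi \<alpha> ` ?L"
        using semigroup_ideal_single_times[OF L_ideal, of h c k]
        by (auto simp: Psi_mult Psi_single intro!: image_eqI[of _ _ "Poly_Mapping.single c k * h"])
    qed
    fix f assume f: "f \<in> I"
    show "lead_form w f \<in> Psi \<alpha> ` ?L"
    proof (cases "f = 0")
      case True
      then show ?thesis using semigroup_ideal_0[OF L_ideal] by (metis Psi_0 imageI lead_form_0)
    next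
      case False
      then obtain a where a: "a \<in> Poly_Mapping.keys f" "\<And>b. b \<in> Poly_Mapping.keys f \<Longrightarrow> w a \<le> w b"
        using ex_min_key[of f w] by blast
      obtain h where h: "Psi \<alpha> h = f" "exponent_map \<alpha> ` Poly_Mapping.keys h \<subseteq> Poly_Mapping.keys f"
        using Psi_lift[of f \<alpha>] keysI[OF f] S by blast
      have "component {c. ?w c = w a} h \<in> ?L"
        using h f a by (intro component_in_init_ideal[OF submonoid_set_UNIV keysJ]) auto
      moreover have "lead_form w f = Psi \<alpha> (component {c. ?w c = w a} h)"
        using lead_form_eq_component[of a f w] a comp[of "w a" h] h by simp
      ultimately show ?thesis by blast
    qed
  qed

  show "?L = ?R"
  proof (rule antisym[OF LR subsetI])
    fix h assume "h \<in> ?R"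
    then obtain h' where h': "h' \<in> ?L" "Psi \<alpha> h = Psi \<alpha> h'" using image by auto
    have "h - h' \<in> ?L" using h'(2) by (intro kernel) (simp add: Psi_diff)
    then have "(h - h') + h' \<in> ?L" using h'(1) by (rule semigroup_ideal_add[OF L_ideal])
    then show "h \<in> ?L" by simp
  qed
qed

lemma init_ideal_eq_iff:
  fixes w w' :: "int^'n \<Rightarrow> real"
  shows "init_ideal S w I = init_ideal S w' I \<longleftrightarrow>
    init_ideal UNIV (\<lambda>c. w (exponent_map \<alpha> c)) (Psi \<alpha> -` I) =
    init_ideal UNIV (\<lambda>c. w' (exponent_map \<alpha> c)) (Psi \<alpha> -` I)"
proof -
  have "init_ideal S w I = Psi \<alpha> ` init_ideal UNIV (\<lambda>c. w (exponent_map \<alpha> c)) (Psi \<alpha> -` I)" for w :: "int^'n \<Rightarrow> real"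
    using init_ideal_subset_Psi_image[of w] init_ideal_Psi_vimage[of w] by auto
  then show ?thesis by (metis init_ideal_Psi_vimage)
qed

end

lemma phi_inner_nat_vec:
  "phi \<alpha> v \<bullet> nat_vec c = v \<bullet> int_vec (exponent_map \<alpha> c)"
proof -
  have "int_vec (exponent_map \<alpha> c) = (\<Sum>i\<in>UNIV. real (c $ i) *\<^sub>R int_vec (\<alpha> i))"
    by (simp add: int_vec_def exponent_map_def vec_eq_iff)
  then show ?thesis
    by (simp add: phi_def nat_vec_def inner_vec_def[of "vec_lambda _"] inner_sum_right mult.commute)
qed

lemma In_toric_eq_iff:
  fixes \<alpha> :: "'s::finite \<Rightarrow> int^'n" and I :: "(int^'n \<Rightarrow>\<^sub>0 'k::field) set"
  assumes "dual_semigroup \<sigma> = range (exponent_map \<alpha>)" "semigroup_ideal (dual_semigroup \<sigma>) I"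
  shows "In_toric \<sigma> v I = In_toric \<sigma> v' I \<longleftrightarrow>
    In_poly (phi \<alpha> v) (Psi \<alpha> -` I) = In_poly (phi \<alpha> v') (Psi \<alpha> -` I)"
  unfolding In_toric_def In_poly_def phi_inner_nat_vec
  by (rule init_ideal_eq_iff[OF assms])

section \<open>Dickson's lemma\<close>

text \<open>
A monotone subsequence exists in any case; if it is decreasing, it is eventually constant.
\<close>

lemma nat_seq_mono_subseq:
  fixes f :: "nat \<Rightarrow> nat"
  obtains r :: "nat \<Rightarrow> nat" where "strict_mono r" "mono (\<lambda>n. f (r n))"
proof -
  obtain r :: "nat \<Rightarrow> nat" where r: "strict_mono r" "monoseq (\<lambda>n. f (r n))"
    using seq_monosub by blast
  show ?thesis
  proof (cases "mono (\<lambda>n. f (r n))")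
    case True
    with r(1) show ?thesis by (rule that)
  next
    case False
    then have dec: "antimono (\<lambda>n. f (r n))" using r(2) by (simp add: monoseq_iff)
    define m where "m = (LEAST x. x \<in> range (\<lambda>n. f (r n)))"
    have "m \<in> range (\<lambda>n. f (r n))" unfolding m_def by (rule LeastI[of _ "f (r 0)"]) auto
    then obtain N where N: "m = f (r N)" by auto
    have "f (r (n + N)) = m" for n
    proof (rule antisym)
      show "f (r (n + N)) \<le> m" using antimonoD[OF dec, of N "n + N"] N by simp
      show "m \<le> f (r (n + N))" unfolding m_def by (rule Least_le) auto
    qed
    then have "mono (\<lambda>n. f (r (n + N)))" by (simp add: mono_def)
    moreover have "strict_mono (\<lambda>n. r (n + N))" using r(1) by (simp add: strict_mono_def)
    ultimately show ?thesis using that[of "\<lambda>n. r (n + N)"] by simp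
  qed
qed

lemma dickson_subseq:
  fixes s :: "nat \<Rightarrow> 'i::finite \<Rightarrow> nat"
  obtains r :: "nat \<Rightarrow> nat" where "strict_mono r" "\<And>i. mono (\<lambda>n. s (r n) i)"
proof -
  have "\<exists>r :: nat \<Rightarrow> nat. strict_mono r \<and> (\<forall>i\<in>A. mono (\<lambda>n. s (r n) i))" for A :: "'i set"
    using finite[of A]
  proof (induction A rule: finite_induct)
    case empty
    show ?case using strict_mono_id by blast
  next
    case (insert i A)
    then obtain r :: "nat \<Rightarrow> nat" where r: "strict_mono r" "\<forall>i\<in>A. mono (\<lambda>n. s (r n) i)" by blast
    obtain q :: "nat \<Rightarrow> nat" where q: "strict_mono q" "mono (\<lambda>n. s (r (q n)) i)"
      using nat_seq_mono_subseq[of "\<lambda>n. s (r n) i"] by blast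
    have "mono (\<lambda>n. s (r (q n)) j)" if "j \<in> A" for j
      using r(2) that strict_mono_mono[OF q(1)] by (auto simp: mono_def)
    moreover have "strict_mono (\<lambda>n. r (q n))"
      using strict_mono_o[OF r(1) q(1)] by (simp add: comp_def)
    ultimately show ?case using q(2)
      by (intro exI[of _ "\<lambda>n. r (q n)"]) auto
  qed
  from this[of UNIV] that show ?thesis by auto
qed

text \<open>
The minimal elements of \<open>T\<close> work: an infinite set of them would contain two comparable ones.
\<close>

lemma dickson_finite_basis:
  fixes T :: "('i::finite \<Rightarrow> nat) set"
  obtains B where "finite B" "B \<subseteq> T" "\<And>x. x \<in> T \<Longrightarrow> \<exists>b\<in>B. b \<le> x"
proof -
  define B where "B = {x\<in>T. \<forall>y\<in>T. y \<le> x \<longrightarrow> y = x}"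
  have "finite B"
  proof (rule ccontr)
    assume "infinite B"
    then obtain s :: "nat \<Rightarrow> 'i \<Rightarrow> nat" where s: "inj s" "range s \<subseteq> B"
      using infinite_countable_subset by blast
    obtain r :: "nat \<Rightarrow> nat" where r: "strict_mono r" "\<And>i. mono (\<lambda>n. s (r n) i)"
      using dickson_subseq by blast
    have "s (r 0) \<le> s (r 1)" using monoD[OF r(2), of 0 1] by (simp add: le_fun_def)
    moreover have "s (r 0) \<in> T" "s (r 1) \<in> B" using s(2) by (auto simp: B_def)
    ultimately have "s (r 0) = s (r 1)" by (simp add: B_def)
    then have "r 0 = r 1" using s(1) by (simp add: inj_eq)
    with r(1) show False by (metis less_numeral_extra(1) less_irrefl strict_monoD)
  qed
  moreover have "B \<subseteq> T" by (auto simp: B_def)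
  moreover have "\<exists>b\<in>B. b \<le> x" if "x \<in> T" for x
    using that
  proof (induction "\<Sum>i\<in>UNIV. x i" arbitrary: x rule: less_induct)
    case less
    show ?case
    proof (cases "x \<in> B")
      case False
      then obtain y where y: "y \<in> T" "y \<le> x" "y \<noteq> x" using less.prems by (auto simp: B_def)
      then obtain i where "y i \<noteq> x i" by (auto simp: fun_eq_iff)
      then have "(\<Sum>i\<in>UNIV. y i) < (\<Sum>i\<in>UNIV. x i)"
        using y(2) by (intro sum_strict_mono_ex1) (auto simp: le_fun_def order_less_le)
      from less.hyps[OF this y(1)] y(2) show ?thesis by (meson order_trans)
    qed auto
  qed
  ultimately show ?thesis by (rule that)
qed


section \<open>Standard bases and division\<close>

definition translation_invariant :: "('m::plus \<Rightarrow> 'w::linorder) \<Rightarrow> bool"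
  where "translation_invariant w \<longleftrightarrow> (\<forall>a b c. w (c + a) \<le> w (c + b) \<longleftrightarrow> w a \<le> w b)"

definition leading_exponent :: "('m \<Rightarrow> 'w::linorder) \<Rightarrow> ('m \<Rightarrow>\<^sub>0 'k::zero) \<Rightarrow> 'm \<Rightarrow> bool"
  where "leading_exponent w f a \<longleftrightarrow>
    a \<in> Poly_Mapping.keys f \<and> (\<forall>b\<in>Poly_Mapping.keys f. w a \<le> w b)"

definition total_degree :: "nat^'s \<Rightarrow> nat"
  where "total_degree c = (\<Sum>i\<in>UNIV. c $ i)"

lemma total_degree_add: "total_degree (c + d) = total_degree c + total_degree d"
  by (simp add: total_degree_def sum.distrib)

lemma finite_total_degree_le: "finite {c :: nat^'s. total_degree c \<le> d}"
proof (rule finite_subset)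
  show "{c :: nat^'s. total_degree c \<le> d} \<subseteq> vec_lambda ` (UNIV \<rightarrow>\<^sub>E {..d})"
  proof
    fix c :: "nat^'s" assume "c \<in> {c. total_degree c \<le> d}"
    then have "c $ i \<le> d" for i
      using member_le_sum[of i UNIV "\<lambda>i. c $ i"] by (simp add: total_degree_def)
    then show "c \<in> vec_lambda ` (UNIV \<rightarrow>\<^sub>E {..d})"
      by (intro image_eqI[of _ _ "vec_nth c"]) (auto simp: PiE_iff)
  qed
qed (intro finite_imageI finite_PiE, auto)

text \<open>
A standard basis in a filtered sense: the multiple of \<open>g\<close> that cancels the leading term of \<open>f\<close> does
not exceed any total degree bound \<open>d\<close> for \<open>f\<close>. This is the notion that homogenizing with an extra
variable would give. It keeps division inside a finite set of monomials, although \<open>w\<close> is in general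
not a well-order on exponents.
\<close>

definition standard_basis ::
    "(nat^'s \<Rightarrow> 'w::linorder) \<Rightarrow> (nat^'s \<Rightarrow>\<^sub>0 'k::zero) set \<Rightarrow> (nat^'s \<Rightarrow>\<^sub>0 'k) set \<Rightarrow> bool"
  where "standard_basis w J G \<longleftrightarrow> finite G \<and> G \<subseteq> J \<and>
    (\<forall>f\<in>J. \<forall>b d. leading_exponent w f b \<and> (\<forall>x\<in>Poly_Mapping.keys f. total_degree x \<le> d) \<longrightarrow>
      (\<exists>g\<in>G. \<exists>a c. leading_exponent w g a \<and> b = c + a \<and>
        (\<forall>x\<in>Poly_Mapping.keys g. total_degree (c + x) \<le> d)))"

text \<open>
A leading exponent \<open>a\<close> and a degree bound \<open>d\<close> are encoded as a vector with the extra entry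
\<open>d - total_degree a\<close>, the exponent of a homogenizing variable. Comparing these vectors entrywise
expresses divisibility of leading terms that respects degree bounds, so Dickson's lemma applies.
\<close>

lemma ex_standard_basis:
  fixes w :: "nat^'s \<Rightarrow> 'w::linorder" and J :: "(nat^'s \<Rightarrow>\<^sub>0 'k::zero) set"
  obtains G where "standard_basis w J G"
proof -
  define enc :: "nat^'s \<Rightarrow> nat \<Rightarrow> 's option \<Rightarrow> nat"
    where "enc a d = (\<lambda>i. case i of None \<Rightarrow> d - total_degree a | Some i \<Rightarrow> a $ i)" for a d
  define P where "P f a d \<longleftrightarrow> f \<in> J \<and> leading_exponent w f a \<and>
    (\<forall>x\<in>Poly_Mapping.keys f. total_degree x \<le> d)" for f a d
  obtain B where B: "finite B" "B \<subseteq> {enc a d | a d. \<exists>f. P f a d}"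
    "\<And>x. x \<in> {enc a d | a d. \<exists>f. P f a d} \<Longrightarrow> \<exists>b\<in>B. b \<le> x"
    using dickson_finite_basis by blast
  have "\<forall>x\<in>B. \<exists>f. \<exists>a d. P f a d \<and> x = enc a d" using B(2) by blast
  then obtain F where F: "\<forall>x\<in>B. \<exists>a d. P (F x) a d \<and> x = enc a d" by (rule bchoice[THEN exE])
  have "standard_basis w J (F ` B)"
    unfolding standard_basis_def
  proof (intro conjI ballI allI impI)
    show "finite (F ` B)" using B(1) by simp
    show "F ` B \<subseteq> J" using F by (auto simp: P_def)
    fix f b d
    assume f: "f \<in> J" "leading_exponent w f b \<and> (\<forall>x\<in>Poly_Mapping.keys f. total_degree x \<le> d)"
    then have "P f b d" by (simp add: P_def)
    then obtain x where x: "x \<in> B" "x \<le> enc b d" using B(3) by blast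
    with F obtain a d' where a: "P (F x) a d'" "x = enc a d'" by blast
    have le: "a $ i \<le> b $ i" for i
      using x(2) a(2) by (auto simp: enc_def le_fun_def dest: spec[of _ "Some i"])
    have slack: "d' - total_degree a \<le> d - total_degree b"
      using x(2) a(2) by (auto simp: enc_def le_fun_def dest: spec[of _ None])
    have bounds: "total_degree a \<le> d'" "total_degree b \<le> d"
      using a(1) f(2) by (auto simp: P_def leading_exponent_def)
    have b: "b = (b - a) + a" using le by (simp add: vec_eq_iff)
    then have deg: "total_degree b = total_degree (b - a) + total_degree a"
      by (metis total_degree_add)
    have "total_degree ((b - a) + y) \<le> d" if "y \<in> Poly_Mapping.keys (F x)" for y
    proof -
      have "total_degree y \<le> d'" using a(1) that by (simp add: P_def)
      then show ?thesis using deg slack bounds unfolding total_degree_add by linarith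
    qed
    then show "\<exists>g\<in>F ` B. \<exists>a c. leading_exponent w g a \<and> b = c + a \<and>
        (\<forall>x\<in>Poly_Mapping.keys g. total_degree (c + x) \<le> d)"
      using a(1) b x(1) by (auto simp: P_def)
  qed
  then show ?thesis by (rule that)
qed

lemma lookup_single_times:
  fixes f :: "'m::cancel_comm_monoid_add \<Rightarrow>\<^sub>0 'k::comm_ring"
  shows "Poly_Mapping.lookup (Poly_Mapping.single c k * f) (c + a) = k * Poly_Mapping.lookup f a"
  by (simp add: single_times_eq_sum lookup_sum lookup_single when_def in_keys_iff)

text \<open>
The order \<open>K\<close> drives the division while \<open>w\<close> is the weight of interest; \<open>w\<close> only has to be refined by
\<open>K\<close> on the finitely many members of \<open>G\<close>. Subtracting a multiple of some \<open>g\<close> that cancels the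
\<open>K\<close>-leading term of \<open>f\<close> keeps the bound \<open>e\<close> and changes the component of weight \<open>e\<close> by zero or by a
multiple of \<open>lead_form w g\<close>. Since \<open>K\<close> is injective the \<open>K\<close>-leading exponent strictly increases,
among the finitely many exponents of degree at most \<open>d\<close>.
\<close>

lemma component_in_ideal_of_standard_basis:
  fixes K :: "nat^'s \<Rightarrow> 'v::linorder" and w :: "nat^'s \<Rightarrow> 'w::linorder"
    and J A :: "(nat^'s \<Rightarrow>\<^sub>0 'k::field) set"
  assumes J: "semigroup_ideal UNIV J" and A: "semigroup_ideal UNIV A"
    and K: "translation_invariant K" "inj K" and w: "translation_invariant w"
    and G: "standard_basis K J G"
    and leading: "\<And>g a. g \<in> G \<Longrightarrow> leading_exponent K g a \<Longrightarrow> leading_exponent w g a"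
    and GA: "\<And>g. g \<in> G \<Longrightarrow> lead_form w g \<in> A"
    and f: "f \<in> J" "\<And>a. a \<in> Poly_Mapping.keys f \<Longrightarrow> e \<le> w a"
  shows "component {a. w a = e} f \<in> A"
proof -
  define d where "d = (\<Sum>x\<in>Poly_Mapping.keys f. total_degree x)"
  have d: "\<forall>x\<in>Poly_Mapping.keys f. total_degree x \<le> d"
    unfolding d_def by (auto intro: member_le_sum)
  define U where "U f = {b. total_degree b \<le> d \<and> (\<exists>a\<in>Poly_Mapping.keys f. K a \<le> K b)}"
    for f :: "nat^'s \<Rightarrow>\<^sub>0 'k"
  have fin: "finite (U f)" for f
    using finite_total_degree_le[of d] by (rule finite_subset[rotated]) (auto simp: U_def)
  show ?thesis
    using f d
  proof (induction "card (U f)" arbitrary: f rule: less_induct)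
    case less
    show ?case
    proof (cases "f = 0")
      case True
      then show ?thesis using semigroup_ideal_0[OF A] by simp
    next
      case False
      then obtain b where b: "leading_exponent K f b"
        using ex_min_key[of f K] by (auto simp: leading_exponent_def)
      obtain g a c where g: "g \<in> G" "leading_exponent K g a" "b = c + a"
        "\<forall>x\<in>Poly_Mapping.keys g. total_degree (c + x) \<le> d"
        using G less.prems(1,3) b unfolding standard_basis_def by blast
      define q where "q = Poly_Mapping.lookup f b / Poly_Mapping.lookup g a"
      define p where "p = Poly_Mapping.single c q * g"
      define f' where "f' = f - p"
      have keys_p: "Poly_Mapping.keys p \<subseteq> (\<lambda>x. c + x) ` Poly_Mapping.keys g"
        unfolding p_def by (rule keys_single_times)
      have keys_f': "Poly_Mapping.keys f' \<subseteq> Poly_Mapping.keys f \<union> Poly_Mapping.keys p"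
        unfolding f'_def by (rule keys_diff)
      have "Poly_Mapping.lookup g a \<noteq> 0"
        using g(2) by (simp add: leading_exponent_def in_keys_iff)
      then have "Poly_Mapping.lookup f' b = 0"
        by (simp add: f'_def p_def lookup_minus g(3) lookup_single_times) (simp add: q_def g(3))
      then have b_notin: "b \<notin> Poly_Mapping.keys f'" by (simp add: in_keys_iff)
      have Kp: "K b \<le> K x" if "x \<in> Poly_Mapping.keys p" for x
        using that keys_p g(2,3) K(1) by (auto simp: leading_exponent_def translation_invariant_def)
      have Kf': "K b < K x" if x: "x \<in> Poly_Mapping.keys f'" for x
      proof -
        have "K b \<le> K x" using x keys_f' Kp b by (auto simp: leading_exponent_def)
        moreover have "K b \<noteq> K x" using x b_notin K(2) by (auto simp: inj_eq)
        ultimately show ?thesis by simp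
      qed
      have wga: "leading_exponent w g a" using g leading by blast
      have wb: "e \<le> w b" using less.prems(2) b by (simp add: leading_exponent_def)
      have wp: "w b \<le> w x" if "x \<in> Poly_Mapping.keys p" for x
        using that keys_p wga g(3) w by (auto simp: leading_exponent_def translation_invariant_def)
      have "U f' \<subset> U f"
      proof
        show "U f' \<subseteq> U f"
        proof
          fix y assume "y \<in> U f'"
          then obtain x where "total_degree y \<le> d" "x \<in> Poly_Mapping.keys f'" "K x \<le> K y"
            by (auto simp: U_def)
          moreover from this have "K b \<le> K y" using Kf'[of x] by simp
          ultimately show "y \<in> U f" using b by (auto simp: U_def leading_exponent_def)
        qed
        have "b \<in> U f" using b less.prems(3) by (auto simp: U_def leading_exponent_def)
        moreover have "b \<notin> U f'" using Kf' by (auto simp: U_def not_le)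
        ultimately show "U f' \<noteq> U f" by blast
      qed
      then have "card (U f') < card (U f)" using fin by (rule psubset_card_mono[rotated])
      moreover have "f' \<in> J"
        unfolding f'_def p_def using less.prems(1) g(1) G
        by (intro semigroup_ideal_diff[OF J] semigroup_ideal_single_times[OF J])
          (auto simp: standard_basis_def)
      moreover have "e \<le> w x" if "x \<in> Poly_Mapping.keys f'" for x
        using that keys_f' less.prems(2) wp wb by (blast intro: order_trans)
      moreover have "\<forall>x\<in>Poly_Mapping.keys f'. total_degree x \<le> d"
        using keys_f' keys_p g(4) less.prems(3) by blast
      ultimately have f'A: "component {a. w a = e} f' \<in> A" using less.hyps by blast
      have pA: "component {a. w a = e} p \<in> A"
      proof (cases "w b = e")
        case True
        have "w (c + x) = e \<longleftrightarrow> w x = w a" for x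
          using w True g(3) unfolding translation_invariant_def by (metis order_antisym order_refl)
        then have "component {a. w a = e} p = Poly_Mapping.single c q * component {x. w x = w a} g"
          unfolding p_def component_single_times by simp
        also have "component {x. w x = w a} g = lead_form w g"
          using wga lead_form_eq_component[of a g w] by (simp add: leading_exponent_def)
        finally show ?thesis
          using semigroup_ideal_single_times[OF A GA[OF g(1)]] by simp
      next
        case False
        then have "component {a. w a = e} p = 0"
          using wp wb by (intro component_eq_0) force
        then show ?thesis using semigroup_ideal_0[OF A] by simp
      qed
      have "component {a. w a = e} f = component {a. w a = e} f' + component {a. w a = e} p"
        by (simp add: f'_def component_add[symmetric])
      then show ?thesis using semigroup_ideal_add[OF A f'A pA] by simp
    qed
  qed
qed

section \<open>Initial ideals along a line\<close>

abbreviation weight :: "real^'s \<Rightarrow> nat^'s \<Rightarrow> real"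
  where "weight x c \<equiv> x \<bullet> nat_vec c"

text \<open>
Lists of linear forms, compared lexicographically, serve both as tie-breaking monomial orders and as
the limit, for small \<open>\<epsilon> > 0\<close>, of the weights \<open>x + \<epsilon> u\<close>.
\<close>

definition lex_weight :: "(real^'s) list \<Rightarrow> nat^'s \<Rightarrow> real list"
  where "lex_weight xs c = map (\<lambda>x. weight x c) xs"

lemma nat_vec_add: "nat_vec (c + d) = nat_vec c + nat_vec d"
  by (simp add: nat_vec_def vec_eq_iff)

lemma weight_add: "weight x (c + d) = weight x c + weight x d"
  by (simp add: nat_vec_add inner_add_right)

lemma translation_invariant_weight: "translation_invariant (weight x)"
  by (simp add: translation_invariant_def weight_add)

lemma translation_invariant_lex_weight: "translation_invariant (lex_weight xs)"
  unfolding translation_invariant_def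
proof (intro allI)
  fix a b c
  show "lex_weight xs (c + a) \<le> lex_weight xs (c + b) \<longleftrightarrow> lex_weight xs a \<le> lex_weight xs b"
    by (induction xs) (simp_all add: lex_weight_def weight_add)
qed

definition homogeneity_space :: "(nat^'s \<Rightarrow>\<^sub>0 'k::field) set \<Rightarrow> (real^'s) set"
  where "homogeneity_space L = {u. \<forall>g\<in>L. \<forall>e. component {c. weight u c = e} g \<in> L}"

text \<open>
Components for a sum of two weights are obtained by taking components for one of them and then for
the other.
\<close>

lemma subspace_homogeneity_space:
  assumes L: "semigroup_ideal UNIV L"
  shows "subspace (homogeneity_space L)"
proof (rule subspaceI)
  show "0 \<in> homogeneity_space L"
    using semigroup_ideal_0[OF L]
    by (auto simp: homogeneity_space_def component_id component_eq_0)
next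
  fix u v assume u: "u \<in> homogeneity_space L" and v: "v \<in> homogeneity_space L"
  have "component {c. weight (u + v) c = e} g \<in> L" if g: "g \<in> L" for g e
  proof -
    let ?g = "\<lambda>l. component {c. weight u c = l} g"
    have "component {c. weight (u + v) c = e} g =
        component {c. weight (u + v) c = e} (\<Sum>l\<in>weight u ` Poly_Mapping.keys g. ?g l)"
      by (simp only: sum_components)
    also have "\<dots> = (\<Sum>l\<in>weight u ` Poly_Mapping.keys g. component {c. weight v c = e - l} (?g l))"
      unfolding component_sum
      by (intro sum.cong refl component_cong) (auto simp: keys_component inner_add_left)
    also have "\<dots> \<in> L"
      using u v g by (intro semigroup_ideal_sum[OF L]) (auto simp: homogeneity_space_def)
    finally show ?thesis .
  qed
  then show "u + v \<in> homogeneity_space L" by (simp add: homogeneity_space_def)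
next
  fix t u assume u: "u \<in> homogeneity_space L"
  have "component {c. weight (t *\<^sub>R u) c = e} g \<in> L" if g: "g \<in> L" for g e
  proof (cases "t = 0")
    case True
    then show ?thesis
      using semigroup_ideal_0[OF L] g by (cases "e = 0") (auto simp: component_id component_eq_0)
  next
    case False
    then have "{c. weight (t *\<^sub>R u) c = e} = {c. weight u c = e / t}"
      by (auto simp: field_simps)
    then show ?thesis using u g by (simp add: homogeneity_space_def)
  qed
  then show "t *\<^sub>R u \<in> homogeneity_space L" by (simp add: homogeneity_space_def)
qed

context
  fixes J :: "(nat^'s \<Rightarrow>\<^sub>0 'k::field) set"
  assumes J: "semigroup_ideal UNIV J"
begin

lemma semigroup_ideal_In_poly: "semigroup_ideal UNIV (In_poly x J)"
  unfolding In_poly_def by (rule semigroup_ideal_init_ideal[OF submonoid_set_UNIV]) simp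

lemma lead_form_in_In_poly: "f \<in> J \<Longrightarrow> lead_form (weight x) f \<in> In_poly x J"
  unfolding In_poly_def by (rule lead_form_in_init_ideal[OF submonoid_set_UNIV]) auto

lemma component_in_In_poly:
  "f \<in> J \<Longrightarrow> (\<And>a. a \<in> Poly_Mapping.keys f \<Longrightarrow> e \<le> weight x a) \<Longrightarrow>
    component {a. weight x a = e} f \<in> In_poly x J"
  unfolding In_poly_def by (rule component_in_init_ideal[OF submonoid_set_UNIV]) auto

lemma In_poly_least:
  "semigroup_ideal UNIV A \<Longrightarrow> (\<And>f. f \<in> J \<Longrightarrow> lead_form (weight x) f \<in> A) \<Longrightarrow> In_poly x J \<subseteq> A"
  unfolding In_poly_def by (rule init_ideal_least[OF submonoid_set_UNIV]) auto

text \<open>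
Every homogeneous piece of an initial ideal is itself a component at the lower weight bound of a
single element of the ideal. The property is stated for all \<open>e\<close> at once since it is then preserved
by sums and monomial multiples.
\<close>

lemma In_poly_component_lift:
  assumes "g \<in> In_poly x J"
  shows "\<exists>h\<in>J. (\<forall>a\<in>Poly_Mapping.keys h. e \<le> weight x a) \<and>
    component {a. weight x a = e} h = component {a. weight x a = e} g"
proof -
  let ?P = "\<lambda>g e. \<exists>h\<in>J. (\<forall>a\<in>Poly_Mapping.keys h. e \<le> weight x a) \<and>
    component {a. weight x a = e} h = component {a. weight x a = e} g"
  have "In_poly x J \<subseteq> {g. \<forall>e. ?P g e}"
  proof (rule In_poly_least)
    show "semigroup_ideal UNIV {g. \<forall>e. ?P g e}"
    proof (rule semigroup_idealI)
      show "0 \<in> {g. \<forall>e. ?P g e}"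
        using semigroup_ideal_0[OF J] by (auto intro!: bexI[of _ 0])
    next
      fix f g assume fg: "f \<in> {g. \<forall>e. ?P g e}" "g \<in> {g. \<forall>e. ?P g e}"
      show "f + g \<in> {g. \<forall>e. ?P g e}"
      proof (rule CollectI, rule allI)
        fix e
        obtain h where h: "h \<in> J" "\<forall>a\<in>Poly_Mapping.keys h. e \<le> weight x a"
          "component {a. weight x a = e} h = component {a. weight x a = e} f" using fg(1) by blast
        obtain h' where h': "h' \<in> J" "\<forall>a\<in>Poly_Mapping.keys h'. e \<le> weight x a"
          "component {a. weight x a = e} h' = component {a. weight x a = e} g" using fg(2) by blast
        show "?P (f + g) e"
          using h h' semigroup_ideal_add[OF J h(1) h'(1)] Poly_Mapping.keys_add[of h h']
          by (intro bexI[of _ "h + h'"]) (auto simp: component_add)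
      qed
    next
      fix f c k assume f: "f \<in> {g. \<forall>e. ?P g e}"
      show "Poly_Mapping.single c k * f \<in> {g. \<forall>e. ?P g e}"
      proof (rule CollectI, rule allI)
        fix e
        obtain h where h: "h \<in> J" "\<forall>a\<in>Poly_Mapping.keys h. e - weight x c \<le> weight x a"
          "component {a. weight x a = e - weight x c} h = component {a. weight x a = e - weight x c} f"
          using f by blast
        have shift: "{a. weight x (c + a) = e} = {a. weight x a = e - weight x c}"
          by (auto simp: weight_add)
        have "e \<le> weight x a" if a: "a \<in> Poly_Mapping.keys (Poly_Mapping.single c k * h)" for a
        proof -
          obtain b where "b \<in> Poly_Mapping.keys h" "a = c + b"
            using a keys_single_times[of c k h] by blast
          then show ?thesis using h(2) by (auto simp: weight_add dest!: bspec)
        qed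
        then show "?P (Poly_Mapping.single c k * f) e"
          using h semigroup_ideal_single_times[OF J h(1), of c k]
          by (intro bexI[of _ "Poly_Mapping.single c k * h"]) (auto simp: component_single_times shift)
      qed
    qed simp
    fix f assume f: "f \<in> J"
    show "lead_form (weight x) f \<in> {g. \<forall>e. ?P g e}"
    proof (rule CollectI, rule allI)
      fix e
      show "?P (lead_form (weight x) f) e"
      proof (cases "f = 0")
        case True
        then show ?thesis using f by (intro bexI[of _ f]) auto
      next
        case False
        then obtain a where a: "a \<in> Poly_Mapping.keys f"
          "\<And>b. b \<in> Poly_Mapping.keys f \<Longrightarrow> weight x a \<le> weight x b"
          using ex_min_key[of f "weight x"] by blast
        then have lead: "lead_form (weight x) f = component {b. weight x b = weight x a} f"
          using lead_form_eq_component[of a f "weight x"] by simp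
        show ?thesis
        proof (cases "e = weight x a")
          case True
          then show ?thesis using a f by (intro bexI[of _ f]) (auto simp: lead component_component)
        next
          case False
          then have "component {b. weight x b = e} (lead_form (weight x) f) = 0"
            unfolding lead by (intro component_eq_0) (auto simp: keys_component)
          then show ?thesis using semigroup_ideal_0[OF J] by (intro bexI[of _ 0]) auto
        qed
      qed
    qed
  qed
  with assms show ?thesis by blast
qed

lemma weight_in_homogeneity_space: "x \<in> homogeneity_space (In_poly x J)"
proof -
  have "component {c. weight x c = e} g \<in> In_poly x J" if "g \<in> In_poly x J" for g e
    using In_poly_component_lift[OF that, of e] component_in_In_poly[of _ e x] by metis
  then show ?thesis by (simp add: homogeneity_space_def)
qed

text \<open>
Take a standard basis \<open>G\<close> for a total order that refines the lexicographic weight \<open>[x, u]\<close>. On the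
finite set \<open>G\<close> the weight \<open>y = x + \<epsilon> u\<close> orders exponents exactly as \<open>[x, u]\<close> does once \<open>\<epsilon>\<close> is small.
Dividing with respect to \<open>y\<close> shows that the initial ideal at \<open>y\<close> is generated by the leading forms of
\<open>G\<close>, which are \<open>u\<close>-components of elements of the initial ideal at \<open>x\<close>, hence in it by homogeneity.
Conversely, the initial ideal at \<open>x\<close> is spanned by elements homogeneous for both \<open>x\<close> and \<open>u\<close>, and
dividing with respect to \<open>[x, u]\<close> expresses these through the same leading forms.
\<close>

lemma In_poly_locally_constant:
  assumes u: "u \<in> homogeneity_space (In_poly x J)"
  shows "eventually (\<lambda>\<epsilon>. In_poly (x + \<epsilon> *\<^sub>R u) J = In_poly x J) (at_right 0)"
proof -
  obtain xs :: "'s list" where xs: "set xs = UNIV" using finite_list[OF finite] by blast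
  \<comment> \<open>The unit vectors break all ties.\<close>
  define K where "K = lex_weight (x # u # map (\<lambda>i. axis i 1) xs)"
  have K_inv: "translation_invariant K" unfolding K_def by (rule translation_invariant_lex_weight)
  have K_inj: "inj K"
  proof (rule injI)
    fix a b assume "K a = K b"
    then have "weight (axis i 1) a = weight (axis i 1) b" for i
      using xs by (auto simp: K_def lex_weight_def)
    then show "a = b" by (simp add: inner_axis' nat_vec_def vec_eq_iff)
  qed
  obtain G where G: "standard_basis K J G" using ex_standard_basis by blast
  then have fin: "finite G" and GJ: "G \<subseteq> J" by (auto simp: standard_basis_def)
  have "eventually (\<lambda>\<epsilon>. weight (x + \<epsilon> *\<^sub>R u) a \<le> weight (x + \<epsilon> *\<^sub>R u) b \<longleftrightarrow>
      lex_weight [x, u] a \<le> lex_weight [x, u] b) (at_right 0)" for a b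
  proof -
    have lex: "lex_weight [x, u] a \<le> lex_weight [x, u] b \<longleftrightarrow>
        weight x a < weight x b \<or> weight x a = weight x b \<and> weight u a \<le> weight u b"
      by (auto simp: lex_weight_def)
    have lim: "((\<lambda>\<epsilon>. weight (x + \<epsilon> *\<^sub>R u) c) \<longlongrightarrow> weight (x + 0 *\<^sub>R u) c) (at_right 0)" for c
      by (intro tendsto_intros)
    consider "weight x a < weight x b" | "weight x b < weight x a" | "weight x a = weight x b"
      by linarith
    then show ?thesis
    proof cases
      case 1
      have "eventually (\<lambda>\<epsilon>. weight (x + \<epsilon> *\<^sub>R u) a < weight (x + \<epsilon> *\<^sub>R u) b) (at_right 0)"
        using order_tendstoD(1)[OF tendsto_diff[OF lim[of b] lim[of a]], of 0] 1 by simp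
      then show ?thesis by eventually_elim (use 1 lex in auto)
    next
      case 2
      have "eventually (\<lambda>\<epsilon>. weight (x + \<epsilon> *\<^sub>R u) b < weight (x + \<epsilon> *\<^sub>R u) a) (at_right 0)"
        using order_tendstoD(1)[OF tendsto_diff[OF lim[of a] lim[of b]], of 0] 2 by simp
      then show ?thesis by eventually_elim (use 2 lex in auto)
    next
      case 3
      have "eventually (\<lambda>\<epsilon>. \<epsilon> > (0::real)) (at_right 0)" by (rule eventually_at_right_less)
      then show ?thesis
        by eventually_elim (use 3 lex in \<open>auto simp: inner_add_left\<close>)
    qed
  qed
  then have "eventually (\<lambda>\<epsilon>. \<forall>g\<in>G. \<forall>a\<in>Poly_Mapping.keys g. \<forall>b\<in>Poly_Mapping.keys g.
      weight (x + \<epsilon> *\<^sub>R u) a \<le> weight (x + \<epsilon> *\<^sub>R u) b \<longleftrightarrow>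
      lex_weight [x, u] a \<le> lex_weight [x, u] b) (at_right 0)"
    using fin by (intro eventually_ball_finite ballI finite_keys)
  then show ?thesis
  proof eventually_elim
    case (elim \<epsilon>)
    define y where "y = x + \<epsilon> *\<^sub>R u"
    let ?L = "In_poly x J" and ?N = "In_poly y J"
    have lead_K: "leading_exponent (lex_weight [x, u]) g a" "leading_exponent (weight x) g a"
      if "leading_exponent K g a" for g :: "nat^'s \<Rightarrow>\<^sub>0 'k" and a
      using that by (auto simp: leading_exponent_def K_def lex_weight_def)
    have lead_y: "leading_exponent (weight y) g a" if "g \<in> G" "leading_exponent K g a" for g a
      using that lead_K(1)[OF that(2)] elim by (auto simp: leading_exponent_def y_def)
    have form_y: "lead_form (weight y) g = lead_form (lex_weight [x, u]) g" if "g \<in> G" for g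
      unfolding lead_form_def using that elim by (intro component_cong) (auto simp: y_def)
    have xu: "component {c. lex_weight [x, u] c = [e, l]} h =
        component {c. weight u c = l} (component {c. weight x c = e} h)" for e l and h :: "nat^'s \<Rightarrow>\<^sub>0 'k"
      by (auto simp: component_component lex_weight_def intro!: component_cong)
    have GL: "lead_form (weight y) g \<in> ?L" if g: "g \<in> G" for g
    proof (cases "g = 0")
      case True
      then show ?thesis using semigroup_ideal_0[OF semigroup_ideal_In_poly] by simp
    next
      case False
      then obtain a where a: "leading_exponent (lex_weight [x, u]) g a"
        using ex_min_key[of g "lex_weight [x, u]"] by (auto simp: leading_exponent_def)
      have "lead_form (weight y) g = component {c. lex_weight [x, u] c = [weight x a, weight u a]} g"
        using form_y[OF g] lead_form_eq_component[of a g "lex_weight [x, u]"] a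
        by (simp add: leading_exponent_def lex_weight_def)
      moreover have "component {c. weight x c = weight x a} g \<in> ?L"
        using g GJ a by (intro component_in_In_poly) (auto simp: leading_exponent_def lex_weight_def)
      ultimately show ?thesis using u by (simp add: xu homogeneity_space_def)
    qed
    have "?N \<subseteq> ?L"
    proof (rule In_poly_least[OF semigroup_ideal_In_poly])
      fix f assume f: "f \<in> J"
      show "lead_form (weight y) f \<in> ?L"
      proof (cases "f = 0")
        case True
        then show ?thesis using semigroup_ideal_0[OF semigroup_ideal_In_poly] by simp
      next
        case False
        then obtain a where a: "a \<in> Poly_Mapping.keys f"
          "\<And>b. b \<in> Poly_Mapping.keys f \<Longrightarrow> weight y a \<le> weight y b"
          using ex_min_key[of f "weight y"] by blast
        have "component {b. weight y b = weight y a} f \<in> ?L"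
          by (rule component_in_ideal_of_standard_basis[OF J semigroup_ideal_In_poly K_inv K_inj
                translation_invariant_weight G lead_y GL f a(2)])
        then show ?thesis using lead_form_eq_component[of a f "weight y"] a by simp
      qed
    qed
    moreover have "?L \<subseteq> ?N"
    proof
      fix f assume f: "f \<in> ?L"
      have "component {c. weight u c = l} (component {c. weight x c = e} f) \<in> ?N" for e l
      proof -
        define q where "q = component {c. weight u c = l} (component {c. weight x c = e} f)"
        have "q \<in> ?L"
          using f u weight_in_homogeneity_space[of x] by (simp add: q_def homogeneity_space_def)
        then obtain h where h: "h \<in> J" "\<forall>a\<in>Poly_Mapping.keys h. e \<le> weight x a"
          "component {a. weight x a = e} h = component {a. weight x a = e} q"
          using In_poly_component_lift[of q x e] by blast
        have q: "component {a. weight x a = e} q = q" "component {a. weight u a = l} q = q"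
          by (auto simp: q_def component_component intro!: component_cong)
        have keys: "[e, l] \<le> lex_weight [x, u] a" if a: "a \<in> Poly_Mapping.keys h" for a
        proof (cases "weight x a = e")
          case True
          then have "a \<in> Poly_Mapping.keys (component {a. weight x a = e} h)"
            using a by (simp add: keys_component)
          then have "weight u a = l" unfolding h(3) q(1) by (simp add: q_def keys_component)
          with True show ?thesis by (simp add: lex_weight_def)
        next
          case False
          with h(2) a show ?thesis by (force simp: lex_weight_def)
        qed
        have GN: "lead_form (lex_weight [x, u]) g \<in> ?N" if "g \<in> G" for g
          using form_y[OF that] lead_form_in_In_poly[of g y] GJ that by auto
        have "component {c. lex_weight [x, u] c = [e, l]} h \<in> ?N"
          by (rule component_in_ideal_of_standard_basis[OF J semigroup_ideal_In_poly K_inv K_inj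
                translation_invariant_lex_weight G lead_K(1) GN h(1) keys])
        then show ?thesis unfolding xu h(3) q by (simp add: q_def)
      qed
      then have "(\<Sum>e\<in>weight x ` Poly_Mapping.keys f.
          \<Sum>l\<in>weight u ` Poly_Mapping.keys (component {c. weight x c = e} f).
          component {c. weight u c = l} (component {c. weight x c = e} f)) \<in> ?N"
        by (intro semigroup_ideal_sum[OF semigroup_ideal_In_poly])
      then show "f \<in> ?N" by (simp only: sum_components)
    qed
    ultimately show ?case unfolding y_def by blast
  qed
qed

end

section \<open>Class fans and linear slices\<close>

text \<open>
In the smallest face containing \<open>x\<close>, a supporting hyperplane at \<open>x\<close> would cut out a still smaller one.
\<close>

lemma ex_face_rel_interior:
  fixes S :: "'v::euclidean_space set"
  assumes S: "convex S" and x: "x \<in> S"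
  obtains F where "F face_of S" "x \<in> rel_interior F"
proof -
  define F where "F = \<Inter>{T. T face_of S \<and> x \<in> T}"
  have F: "F face_of S" unfolding F_def
    by (rule face_of_Inter) (use face_of_refl[OF S] x in auto)
  have xF: "x \<in> F" by (auto simp: F_def)
  have F_min: "F \<subseteq> T" if "T face_of S" "x \<in> T" for T using that by (auto simp: F_def)
  have "x \<in> rel_interior F"
  proof (rule ccontr)
    assume "x \<notin> rel_interior F"
    with face_of_imp_convex[OF F] xF obtain a
      where a: "\<And>y. y \<in> F \<Longrightarrow> a \<bullet> x \<le> a \<bullet> y" "\<And>y. y \<in> rel_interior F \<Longrightarrow> a \<bullet> x < a \<bullet> y"
      by (rule supporting_hyperplane_rel_boundary) blast
    have "(F \<inter> {y. a \<bullet> y = a \<bullet> x}) face_of F"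
      using face_of_Int_supporting_hyperplane_ge[OF face_of_imp_convex[OF F], where a = a and b = "a \<bullet> x"] a(1)
      by blast
    then have "(F \<inter> {y. a \<bullet> y = a \<bullet> x}) face_of S" using F by (rule face_of_trans)
    then have "F \<subseteq> F \<inter> {y. a \<bullet> y = a \<bullet> x}" using xF by (intro F_min) auto
    moreover obtain y where "y \<in> rel_interior F"
      using xF rel_interior_eq_empty[OF face_of_imp_convex[OF F]] by blast
    ultimately show False using a(2)[of y] rel_interior_subset[of F] by auto
  qed
  with F show ?thesis by (rule that)
qed

text \<open>
The half-open segment from \<open>q\<close> to any point of \<open>S \<inter> P\<close> stays in the relative interior and in \<open>P\<close>.
\<close>

lemma subset_closure_of_rel_interior_slice:
  fixes S :: "'v::euclidean_space set"
  assumes S: "convex S" and P: "convex P" and q: "q \<in> rel_interior S" "q \<in> P"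
  shows "S \<inter> P \<subseteq> closure (rel_interior S \<inter> P)"
proof
  fix z assume z: "z \<in> S \<inter> P"
  show "z \<in> closure (rel_interior S \<inter> P)"
  proof (cases "z = q")
    case True
    with q subsetD[OF closure_subset, of q] show ?thesis by simp
  next
    case False
    have "open_segment q z \<subseteq> rel_interior S"
      using z subsetD[OF closure_subset, of z S]
      by (intro rel_interior_closure_convex_segment[OF S q(1)]) simp
    moreover have "open_segment q z \<subseteq> P"
      using P q(2) z by (metis IntE convex_contains_open_segment)
    ultimately have "closure (open_segment q z) \<subseteq> closure (rel_interior S \<inter> P)"
      by (intro closure_mono) auto
    then show ?thesis using False by (simp add: closure_open_segment subset_iff)
  qed
qed

definition equivalence_class :: "('v \<Rightarrow> 'i) \<Rightarrow> 'v set \<Rightarrow> 'v \<Rightarrow> 'v set"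
  where "equivalence_class I X x = {y \<in> X. I y = I x}"

lemma class_closures_eq: "class_closures I X = (\<lambda>x. closure (equivalence_class I X x)) ` X"
proof -
  have "{(v, v'). v \<in> X \<and> v' \<in> X \<and> I v = I v'} `` {x} = equivalence_class I X x" if "x \<in> X" for x
    using that by (auto simp: equivalence_class_def)
  then have "X // {(v, v'). v \<in> X \<and> v' \<in> X \<and> I v = I v'} = equivalence_class I X ` X"
    unfolding quotient_def by blast
  then show ?thesis by (simp add: class_closures_def image_image)
qed

text \<open>
The properties of initial ideals that the convex geometry uses. In the application \<open>I x\<close> is the
initial ideal at the weight \<open>x\<close>, and \<open>W x\<close> is the space of all weights for which \<open>I x\<close> is
homogeneous. The set \<open>L\<close> is the linear space with which the fan on \<open>X\<close> is to be intersected.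
\<close>

locale homogeneous_class_fan =
  fixes I :: "'v::euclidean_space \<Rightarrow> 'i" and X L :: "'v set" and W :: "'v \<Rightarrow> 'v set"
  assumes polyhedron_X: "polyhedron X" and convex_cone_X: "convex_cone X"
    and subspace_L: "subspace L"
    and fan: "polyhedral_fan (class_fan I X)"
    and subspace_W: "subspace (W x)"
    and class_subset_W: "x \<in> X \<Longrightarrow> y \<in> X \<Longrightarrow> I y = I x \<Longrightarrow> y \<in> W x"
    and locally_constant: "u \<in> W x \<Longrightarrow> eventually (\<lambda>\<epsilon>. I (x + \<epsilon> *\<^sub>R u) = I x) (at_right 0)"
begin

lemma convex_X: "convex X" and closed_X: "closed X"
  using polyhedron_X by (simp_all add: polyhedron_imp_convex polyhedron_imp_closed)

abbreviation cell :: "'v \<Rightarrow> 'v set"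
  where "cell x \<equiv> closure (equivalence_class I X x)"

lemma cell_in_fan: "x \<in> X \<Longrightarrow> cell x \<in> class_fan I X"
  by (simp add: class_fan_def class_closures_eq)

lemma mem_cell: "x \<in> X \<Longrightarrow> x \<in> cell x"
  using closure_subset by (force simp: equivalence_class_def)

lemma fan_convex: "\<tau> \<in> class_fan I X \<Longrightarrow> convex \<tau>"
  and fan_convex_cone: "\<tau> \<in> class_fan I X \<Longrightarrow> convex_cone \<tau>"
  and fan_polyhedron: "\<tau> \<in> class_fan I X \<Longrightarrow> polyhedron \<tau>"
  and fan_face: "\<tau> \<in> class_fan I X \<Longrightarrow> F face_of \<tau> \<Longrightarrow> F \<noteq> {} \<Longrightarrow> F \<in> class_fan I X"
  and fan_Int: "\<tau> \<in> class_fan I X \<Longrightarrow> \<tau>' \<in> class_fan I X \<Longrightarrow> (\<tau> \<inter> \<tau>') face_of \<tau>"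
  and fan_finite: "finite (class_fan I X)"
  using fan by (auto simp: polyhedral_fan_def polyhedron_imp_convex)

lemma cell_subset: "cell x \<subseteq> X"
  using closed_X by (intro closure_minimal) (auto simp: equivalence_class_def)

lemma fan_subset: "\<tau> \<in> class_fan I X \<Longrightarrow> \<tau> \<subseteq> X"
  using cell_subset face_of_imp_subset by (fastforce simp: class_fan_def class_closures_eq)

text \<open>
A linear subspace of a finite-dimensional space is closed.
\<close>

lemma cell_subset_W: "x \<in> X \<Longrightarrow> cell x \<subseteq> W x"
  using class_subset_W[of x] closed_subspace[OF subspace_W, of x]
  by (intro closure_minimal) (auto simp: equivalence_class_def)

text \<open>
By the fan property \<open>F \<inter> cell x\<close> is a face of \<open>F\<close>, and a face that contains a relative interior
point is everything.
\<close>

lemma subset_cell: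
  assumes "F \<in> class_fan I X" "x \<in> rel_interior F"
  shows "F \<subseteq> cell x"
proof -
  have "x \<in> F" "x \<in> X" using assms fan_subset rel_interior_subset by blast+
  then have "F \<subseteq> F \<inter> cell x"
    using assms mem_cell[of x]
    by (intro subset_of_face_of[OF fan_Int[OF assms(1) cell_in_fan[of x]] subset_refl]) auto
  then show ?thesis by blast
qed

text \<open>
At every point of the segment from \<open>p\<close> to \<open>q\<close>, both directions of the segment lie in \<open>W\<close>, because
\<open>F\<close> is contained in the cell of that point. So \<open>I\<close> is locally constant along the segment.
\<close>

lemma constant_on_rel_interior:
  assumes F: "F \<in> class_fan I X" and p: "p \<in> rel_interior F" and q: "q \<in> rel_interior F"
  shows "I p = I q"
proof -
  define z where "z t = p + t *\<^sub>R (q - p)" for t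
  have z: "z t \<in> rel_interior F" if "t \<in> {0..1}" for t
  proof -
    have "z t = (1 - t) *\<^sub>R p + t *\<^sub>R q" by (simp add: z_def algebra_simps)
    then show ?thesis
      using convexD_alt[OF convex_rel_interior[OF fan_convex[OF F]] p q, of t] that by auto
  qed
  have "eventually (\<lambda>s. I (z t) = I (z s)) (at t within {0..1})" if t: "t \<in> {0..1}" for t
  proof -
    have "F \<subseteq> W (z t)"
      using subset_cell[OF F z[OF t]] cell_subset_W[of "z t"] z[OF t] fan_subset[OF F]
        rel_interior_subset[of F] by blast
    then have W: "q - p \<in> W (z t)" "p - q \<in> W (z t)"
      using p q rel_interior_subset[of F] by (auto intro!: subspace_diff subspace_W)
    have "eventually (\<lambda>\<epsilon>. I (z t) = I (z (\<epsilon> + t))) (at_right 0)"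
      using locally_constant[OF W(1)] by eventually_elim (simp add: z_def algebra_simps)
    then have right: "eventually (\<lambda>s. I (z t) = I (z s)) (at_right t)"
      by (simp add: eventually_at_right_to_0[of _ t])
    have "eventually (\<lambda>\<epsilon>. I (z t) = I (z (- (\<epsilon> + - t)))) (at_right 0)"
      using locally_constant[OF W(2)] by eventually_elim (simp add: z_def algebra_simps)
    then have left: "eventually (\<lambda>s. I (z t) = I (z s)) (at_left t)"
      by (simp add: eventually_at_left_to_right[of _ t] eventually_at_right_to_0[of _ "- t"])
    from left right have "eventually (\<lambda>s. I (z t) = I (z s)) (at t)"
      by (simp add: eventually_at_split)
    then show ?thesis by (rule filter_leD[OF at_le, rotated]) simp
  qed
  then have "I (z 0) = I (z 1)"
    by (intro connected_local_const[of "{0..1::real}" 0 1 "\<lambda>t. I (z t)"]) auto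
  then show ?thesis by (simp add: z_def)
qed

abbreviation slice :: "'v set"
  where "slice \<equiv> X \<inter> L"

lemma convex_slice: "convex slice" and zero_in_slice: "0 \<in> slice"
  using convex_Int[OF convex_X subspace_imp_convex[OF subspace_L]]
    convex_cone_contains_0[OF convex_cone_X] subspace_0[OF subspace_L] by simp_all

text \<open>
\<open>F\<close> is the smallest face containing the slice of \<open>\<tau>\<close>. Unlike \<open>\<tau>\<close> itself, it has relative interior
points in the slice.
\<close>

lemma ex_face_of_slice:
  assumes \<tau>: "\<tau> \<in> class_fan I X"
  obtains F q where "F face_of \<tau>" "q \<in> rel_interior F" "q \<in> slice" "\<tau> \<inter> slice = F \<inter> slice"
proof -
  have conv: "convex (\<tau> \<inter> slice)" using fan_convex[OF \<tau>] convex_slice by (rule convex_Int)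
  moreover have "0 \<in> \<tau> \<inter> slice"
    using zero_in_slice convex_cone_contains_0[OF fan_convex_cone[OF \<tau>]] by blast
  ultimately obtain q where q: "q \<in> rel_interior (\<tau> \<inter> slice)"
    using rel_interior_eq_empty by blast
  then have q': "q \<in> \<tau> \<inter> slice" using rel_interior_subset by blast
  then obtain F where F: "F face_of \<tau>" "q \<in> rel_interior F"
    using ex_face_rel_interior[OF fan_convex[OF \<tau>], of q] by blast
  have "\<tau> \<inter> slice \<subseteq> F"
    using F q rel_interior_subset[of F] by (intro subset_of_face_of[OF F(1)]) auto
  then have "\<tau> \<inter> slice = F \<inter> slice" using face_of_imp_subset[OF F(1)] by blast
  with F q' show ?thesis by (intro that) auto
qed

text \<open>
The point \<open>p\<close> may lie on the relative boundary of the face \<open>F\<close> that carries the slice of its cell.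
But moving a little from \<open>p\<close> towards a relative interior point \<open>q\<close> of \<open>F\<close> does not change \<open>I\<close>, and
it leads into the relative interior of \<open>F\<close>, on which \<open>I\<close> is constant. So that relative interior
belongs to the class of \<open>p\<close>, and its slice is dense in the slice of the cell.
\<close>

lemma closure_slice_class:
  assumes p: "p \<in> slice"
  shows "closure (equivalence_class I slice p) = cell p \<inter> slice"
proof (rule antisym)
  have "closed slice" using closed_X closed_subspace[OF subspace_L] by (rule closed_Int)
  then have "closure (equivalence_class I slice p) \<subseteq> slice"
    by (intro closure_minimal) (auto simp: equivalence_class_def)
  moreover have "closure (equivalence_class I slice p) \<subseteq> cell p"
    by (intro closure_mono) (auto simp: equivalence_class_def)
  ultimately show "closure (equivalence_class I slice p) \<subseteq> cell p \<inter> slice" by blast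
next
  have pX: "p \<in> X" using p by simp
  note cell = cell_in_fan[OF pX]
  obtain F q where F: "F face_of cell p" "q \<in> rel_interior F" "q \<in> slice"
    and eq: "cell p \<inter> slice = F \<inter> slice" using ex_face_of_slice[OF cell] by blast
  have F_fan: "F \<in> class_fan I X" using F(2) rel_interior_subset by (intro fan_face[OF cell F(1)]) auto
  have pF: "p \<in> F" using eq mem_cell[OF pX] p by blast
  have qF: "q \<in> F" using F(2) rel_interior_subset by blast
  have "q - p \<in> W p"
    using cell_subset_W[OF pX] face_of_imp_subset[OF F(1)] pF qF by (intro subspace_diff subspace_W) auto
  then have "eventually (\<lambda>\<epsilon>. I (p + \<epsilon> *\<^sub>R (q - p)) = I p) (at_right 0)"
    by (rule locally_constant)
  moreover have "eventually (\<lambda>\<epsilon>. \<epsilon> < (1::real)) (at_right 0)"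
    by (rule order_tendstoD(2)[OF tendsto_ident_at]) simp
  moreover have "eventually (\<lambda>\<epsilon>. \<epsilon> > (0::real)) (at_right 0)" by (rule eventually_at_right_less)
  \<comment> \<open>The statement no longer mentions \<open>\<epsilon>\<close>; the filter only supplies one that is small enough.\<close>
  ultimately have "eventually (\<lambda>\<epsilon>. I q = I p) (at_right (0::real))"
  proof eventually_elim
    case (elim \<epsilon>)
    show ?case
    proof (cases "p = q")
      case False
      have "p + \<epsilon> *\<^sub>R (q - p) = (1 - (1 - \<epsilon>)) *\<^sub>R q + (1 - \<epsilon>) *\<^sub>R p" by (simp add: algebra_simps)
      then have "p + \<epsilon> *\<^sub>R (q - p) \<in> open_segment q p"
        unfolding in_segment using False elim by (intro conjI exI[of _ "1 - \<epsilon>"]) auto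
      then have "p + \<epsilon> *\<^sub>R (q - p) \<in> rel_interior F"
        using rel_interior_closure_convex_segment[OF fan_convex[OF F_fan] F(2)] pF closure_subset by blast
      from constant_on_rel_interior[OF F_fan this F(2)] elim show ?thesis by simp
    qed simp
  qed
  then have "I q = I p" by (simp add: eventually_const_iff)
  then have "rel_interior F \<inter> slice \<subseteq> equivalence_class I slice p"
    using constant_on_rel_interior[OF F_fan _ F(2)] by (auto simp: equivalence_class_def)
  then have "closure (rel_interior F \<inter> slice) \<subseteq> closure (equivalence_class I slice p)"
    by (rule closure_mono)
  then show "cell p \<inter> slice \<subseteq> closure (equivalence_class I slice p)"
    unfolding eq
    using subset_closure_of_rel_interior_slice[OF fan_convex[OF F_fan] convex_slice F(2,3)] by blast
qed

text \<open>
Let \<open>F\<close> be the face of \<open>\<tau>\<close> that has a relative interior point \<open>q\<close> of \<open>E\<close> in its relative interior.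
As \<open>L\<close> is affine, \<open>q\<close> is also relatively interior to \<open>F \<inter> L\<close>, so \<open>E\<close> and \<open>F \<inter> L\<close> are two faces of
the slice with a common relative interior point.
\<close>

lemma face_of_slice_eq:
  assumes \<tau>: "\<tau> \<in> class_fan I X" and E: "E face_of \<tau> \<inter> slice" "E \<noteq> {}"
  obtains F where "F \<in> class_fan I X" "E = F \<inter> slice"
proof -
  obtain q where q: "q \<in> rel_interior E"
    using E rel_interior_eq_empty[OF face_of_imp_convex[OF E(1)]] by blast
  then have qE: "q \<in> E" using rel_interior_subset by blast
  then have q\<tau>: "q \<in> \<tau>" "q \<in> slice" using face_of_imp_subset[OF E(1)] by auto
  obtain F where F: "F face_of \<tau>" "q \<in> rel_interior F"
    using ex_face_rel_interior[OF fan_convex[OF \<tau>] q\<tau>(1)] by blast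
  have F_fan: "F \<in> class_fan I X" using F(2) rel_interior_subset by (intro fan_face[OF \<tau> F(1)]) auto
  have "E \<subseteq> F"
    using face_of_imp_subset[OF E(1)] F q rel_interior_subset[of F]
    by (intro subset_of_face_of[OF F(1)]) auto
  moreover have "F \<inter> slice \<subseteq> E"
  proof (rule subset_of_face_of[OF E(1)])
    show "F \<inter> slice \<subseteq> \<tau> \<inter> slice" using face_of_imp_subset[OF F(1)] by blast
    have FL: "F \<inter> slice = F \<inter> L" using fan_subset[OF F_fan] by blast
    have L: "rel_interior L = L" using subspace_L by (simp add: rel_interior_affine subspace_imp_affine)
    have "rel_interior (F \<inter> L) = rel_interior F \<inter> rel_interior L"
      using F(2) q\<tau>(2) subspace_L L
      by (intro convex_rel_interior_inter_two fan_convex[OF F_fan]) (auto simp: subspace_imp_convex)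
    then show "E \<inter> rel_interior (F \<inter> slice) \<noteq> {}"
      unfolding FL L using qE F(2) q\<tau>(2) by blast
  qed
  ultimately have "E = F \<inter> slice" using face_of_imp_subset[OF E(1)] by blast
  with F_fan show ?thesis by (rule that)
qed

text \<open>
That slices of arbitrary cones of the fan occur uses more than closures of classes: the slice of
\<open>\<tau>\<close> is the slice of a face \<open>F\<close> with a relative interior point \<open>q\<close> in \<open>L\<close>, and \<open>F\<close> is a face of the
cell of \<open>q\<close>, even if the class with closure \<open>\<tau>\<close> misses \<open>L\<close>.
\<close>

lemma class_fan_slice: "class_fan I slice = (\<lambda>\<tau>. \<tau> \<inter> slice) ` class_fan I X"
proof (rule antisym)
  have closures: "class_closures I slice = (\<lambda>p. cell p \<inter> slice) ` slice"
    unfolding class_closures_eq by (intro image_cong refl closure_slice_class)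
  show "class_fan I slice \<subseteq> (\<lambda>\<tau>. \<tau> \<inter> slice) ` class_fan I X"
  proof
    fix E assume "E \<in> class_fan I slice"
    then consider p where "p \<in> slice" "E = cell p \<inter> slice"
      | p where "p \<in> slice" "E \<noteq> {}" "E face_of cell p \<inter> slice"
      unfolding class_fan_def closures by blast
    then show "E \<in> (\<lambda>\<tau>. \<tau> \<inter> slice) ` class_fan I X"
    proof cases
      case 1
      then show ?thesis using cell_in_fan by auto
    next
      case 2
      obtain F where "F \<in> class_fan I X" "E = F \<inter> slice"
        using face_of_slice_eq[OF cell_in_fan 2(3,2)] 2(1) by blast
      then show ?thesis by blast
    qed
  qed
  show "(\<lambda>\<tau>. \<tau> \<inter> slice) ` class_fan I X \<subseteq> class_fan I slice"
  proof (rule image_subsetI)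
    fix \<tau> assume \<tau>: "\<tau> \<in> class_fan I X"
    obtain F q where F: "F face_of \<tau>" "q \<in> rel_interior F" "q \<in> slice"
      and eq: "\<tau> \<inter> slice = F \<inter> slice" using ex_face_of_slice[OF \<tau>] by blast
    have F_fan: "F \<in> class_fan I X" using F(2) rel_interior_subset by (intro fan_face[OF \<tau> F(1)]) auto
    have qX: "q \<in> X" using F(3) by simp
    have "F \<subseteq> cell q" by (rule subset_cell[OF F_fan F(2)])
    then have "F face_of cell q"
      using fan_Int[OF cell_in_fan[OF qX] F_fan] by (simp add: Int_absorb1)
    then have "(F \<inter> slice) face_of (cell q \<inter> slice)"
      using convex_slice by (rule face_of_slice)
    moreover have "F \<inter> slice \<noteq> {}" using F(2,3) rel_interior_subset by blast
    ultimately show "\<tau> \<inter> slice \<in> class_fan I slice"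
      unfolding eq class_fan_def closures using F(3) by blast
  qed
qed

lemma polyhedral_fan_slice: "polyhedral_fan (class_fan I slice)"
  unfolding polyhedral_fan_def
proof (intro conjI ballI allI impI)
  show "finite (class_fan I slice)" unfolding class_fan_slice using fan_finite by simp
next
  fix E assume "E \<in> class_fan I slice"
  then obtain \<tau> where \<tau>: "\<tau> \<in> class_fan I X" "E = \<tau> \<inter> slice" unfolding class_fan_slice by blast
  show "polyhedron E"
    unfolding \<tau>(2) using fan_polyhedron[OF \<tau>(1)] polyhedron_X
      affine_imp_polyhedron[OF subspace_imp_affine[OF subspace_L]] by simp
  have "convex_cone (\<Inter>{\<tau>, X, L})"
    using fan_convex_cone[OF \<tau>(1)] convex_cone_X subspace_L
    by (intro convex_cone_Inter) (auto simp: convex_cone_iff subspace_def)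
  then show "convex_cone E" by (simp add: \<tau>(2))
  fix F assume "F face_of E \<and> F \<noteq> {}"
  then show "F \<in> class_fan I slice"
    unfolding class_fan_slice \<tau>(2) using face_of_slice_eq[OF \<tau>(1)] by blast
next
  fix E E' assume "E \<in> class_fan I slice" "E' \<in> class_fan I slice"
  then obtain \<tau> \<tau>' where \<tau>: "\<tau> \<in> class_fan I X" "E = \<tau> \<inter> slice"
    and \<tau>': "\<tau>' \<in> class_fan I X" "E' = \<tau>' \<inter> slice" unfolding class_fan_slice by blast
  have "E \<inter> E' = (\<tau> \<inter> \<tau>') \<inter> slice" "E \<inter> E' = (\<tau>' \<inter> \<tau>) \<inter> slice" using \<tau> \<tau>' by auto
  then show "(E \<inter> E') face_of E" "(E \<inter> E') face_of E'"
    using face_of_slice[OF fan_Int[OF \<tau>(1) \<tau>'(1)] convex_slice]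
      face_of_slice[OF fan_Int[OF \<tau>'(1) \<tau>(1)] convex_slice] \<tau>(2) \<tau>'(2) by simp_all
qed

end

lemma Union_class_fan:
  assumes "closed X"
  shows "\<Union>(class_fan I X) = X"
proof (rule antisym)
  have sub: "closure (equivalence_class I X x) \<subseteq> X" for x
    using assms by (intro closure_minimal) (auto simp: equivalence_class_def)
  then show "\<Union>(class_fan I X) \<subseteq> X"
    using face_of_imp_subset by (fastforce simp: class_fan_def class_closures_eq)
  show "X \<subseteq> \<Union>(class_fan I X)"
  proof
    fix x assume "x \<in> X"
    then have "x \<in> closure (equivalence_class I X x)"
      using closure_subset by (force simp: equivalence_class_def)
    then show "x \<in> \<Union>(class_fan I X)" using \<open>x \<in> X\<close> by (auto simp: class_fan_def class_closures_eq)
  qed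
qed

lemma class_fan_linear_image:
  fixes f :: "'u::euclidean_space \<Rightarrow> 'v::euclidean_space"
  assumes f: "linear f" "inj f"
    and I: "\<And>x y. x \<in> X \<Longrightarrow> y \<in> X \<Longrightarrow> I x = I y \<longleftrightarrow> I' (f x) = I' (f y)"
  shows "class_fan I' (f ` X) = image f ` class_fan I X"
proof -
  have "equivalence_class I' (f ` X) (f x) = f ` equivalence_class I X x" if "x \<in> X" for x
    using I that by (auto simp: equivalence_class_def)
  then have closures: "class_closures I' (f ` X) = image f ` class_closures I X"
    unfolding class_closures_eq image_image
    by (intro image_cong refl) (simp add: closure_injective_linear_image[OF f])
  have faces: "{F. F \<noteq> {} \<and> F face_of f ` C} = image f ` {F. F \<noteq> {} \<and> F face_of C}" for C
    using faces_of_linear_image[OF f, of C] by (auto simp: face_of_linear_image[OF f])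
  have union: "class_fan J Y = class_closures J Y \<union> (\<Union>C\<in>class_closures J Y. {F. F \<noteq> {} \<and> F face_of C})"
    for J :: "'w::euclidean_space \<Rightarrow> 'j" and Y by (auto simp: class_fan_def)
  show ?thesis by (simp only: union closures image_Un image_UN UN_simps faces)
qed

lemma polyhedron_injective_linear_image:
  fixes f :: "'u::euclidean_space \<Rightarrow> 'v::euclidean_space"
  assumes f: "linear f" "inj f" and S: "polyhedron (f ` S)"
  shows "polyhedron S"
proof -
  have "finite (image f ` {F. F face_of S})"
    using S by (simp add: polyhedron_eq_finite_faces faces_of_linear_image[OF f])
  then have "finite {F. F face_of S}"
    by (rule finite_imageD) (simp add: inj_on_def inj_image_eq_iff[OF f(2)])
  then show ?thesis
    using S by (simp add: polyhedron_eq_finite_faces closed_injective_linear_image_eq[OF f]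
        convex_linear_image_eq[OF f])
qed

lemma polyhedral_fan_linear_image:
  fixes f :: "'u::euclidean_space \<Rightarrow> 'v::euclidean_space"
  assumes f: "linear f" "inj f" and fan: "polyhedral_fan (image f ` \<Sigma>)"
  shows "polyhedral_fan \<Sigma>"
  unfolding polyhedral_fan_def
proof (intro conjI ballI allI impI)
  have inj: "inj (image f)" using f(2) by (simp add: inj_image_eq_iff inj_def)
  show "finite \<Sigma>"
    using fan finite_imageD[of "image f" \<Sigma>] inj_on_subset[OF inj] by (auto simp: polyhedral_fan_def)
next
  fix \<tau> assume \<tau>: "\<tau> \<in> \<Sigma>"
  then show "polyhedron \<tau>" "convex_cone \<tau>"
    using fan by (auto simp: polyhedral_fan_def convex_cone_linear_image_eq[OF f]
        intro: polyhedron_injective_linear_image[OF f])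
  fix F assume F: "F face_of \<tau> \<and> F \<noteq> {}"
  then have "f ` F face_of f ` \<tau> \<and> f ` F \<noteq> {}" by (simp add: face_of_linear_image[OF f])
  then have "f ` F \<in> image f ` \<Sigma>" using fan \<tau> by (auto simp: polyhedral_fan_def)
  then show "F \<in> \<Sigma>" by (auto simp: inj_image_eq_iff[OF f(2)])
next
  fix \<tau> \<tau>' assume "\<tau> \<in> \<Sigma>" "\<tau>' \<in> \<Sigma>"
  then have "(f ` \<tau> \<inter> f ` \<tau>') face_of f ` \<tau>" "(f ` \<tau> \<inter> f ` \<tau>') face_of f ` \<tau>'"
    using fan by (auto simp: polyhedral_fan_def)
  then show "(\<tau> \<inter> \<tau>') face_of \<tau>" "(\<tau> \<inter> \<tau>') face_of \<tau>'"
    by (simp_all add: image_Int[OF f(2), symmetric] face_of_linear_image[OF f])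
qed

section \<open>The cone as a linear slice of the orthant\<close>

lemma linear_phi: "linear (phi \<alpha>)"
  by (rule linearI) (simp_all add: phi_def vec_eq_iff inner_add_left)

lemma sum_in_convex_cone:
  assumes "\<And>b. b \<in> B \<Longrightarrow> f b \<in> convex_cone hull S"
  shows "sum f B \<in> convex_cone hull S"
  using assms
  by (induction B rule: infinite_finite_induct)
    (auto intro: convex_cone_hull_contains_0 convex_cone_hull_add)

text \<open>
A separating hyperplane works unless \<open>0\<close> is a convex combination of nonzero elements of \<open>S\<close>; but then
the cone would contain the negative of one of them.
\<close>

lemma strongly_convex_ex_positive:
  fixes S :: "(real^'n) set"
  assumes S: "finite S" and strong: "strongly_convex (convex_cone hull S)"
  obtains u where "\<And>s. s \<in> S \<Longrightarrow> s \<noteq> 0 \<Longrightarrow> 0 < u \<bullet> s"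
proof -
  let ?\<sigma> = "convex_cone hull S" and ?S = "S - {0}"
  have fin: "finite ?S" using S by simp
  have "0 \<notin> convex hull ?S"
  proof
    assume "0 \<in> convex hull ?S"
    then obtain c where c: "\<forall>s\<in>?S. 0 \<le> c s" "sum c ?S = 1" "(\<Sum>s\<in>?S. c s *\<^sub>R s) = 0"
      unfolding convex_hull_finite[OF fin] by blast
    have "\<exists>t\<in>?S. c t \<noteq> 0"
    proof (rule ccontr)
      assume "\<not> (\<exists>t\<in>?S. c t \<noteq> 0)"
      then have "sum c ?S = 0" by (intro sum.neutral) simp
      with c(2) show False by simp
    qed
    then obtain t where t: "t \<in> ?S" "c t \<noteq> 0" by blast
    then have ct: "0 < c t" using c(1) by (simp add: order_less_le)
    have in_cone: "s \<in> ?\<sigma>" if "s \<in> S" for s using that by (rule hull_inc)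
    have "(\<Sum>s\<in>?S - {t}. c s *\<^sub>R s) \<in> ?\<sigma>"
      using c(1) by (intro sum_in_convex_cone convex_cone_hull_mul in_cone) auto
    moreover have "(\<Sum>s\<in>?S - {t}. c s *\<^sub>R s) = - (c t *\<^sub>R t)"
      using c(3) sum.remove[OF fin t(1), of "\<lambda>s. c s *\<^sub>R s"] by (simp add: eq_neg_iff_add_eq_0 add.commute)
    ultimately have "(1 / c t) *\<^sub>R (- (c t *\<^sub>R t)) \<in> ?\<sigma>"
      using ct by (intro convex_cone_hull_mul) auto
    then have "- t \<in> ?\<sigma>" using ct by simp
    then have "t \<in> ?\<sigma> \<inter> uminus ` ?\<sigma>"
      using in_cone[of t] t(1) image_eqI[of t uminus "- t" ?\<sigma>] by simp
    then show False using strong t(1) unfolding strongly_convex_def by simp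
  qed
  with convex_convex_hull compact_imp_closed[OF finite_imp_compact_convex_hull[OF fin]]
  obtain u b where ub: "0 < b" "\<forall>x\<in>convex hull ?S. b < u \<bullet> x"
    using separating_hyperplane_closed_0[of "convex hull ?S"] by blast
  show ?thesis
  proof (rule that)
    fix s assume "s \<in> S" "s \<noteq> 0"
    then have "s \<in> convex hull ?S" by (intro hull_inc) simp
    with ub show "0 < u \<bullet> s" by (meson less_trans)
  qed
qed

text \<open>
Dyadic vectors are dense, and scaling by a power of two makes them integral.
\<close>

lemma ex_integer_vector_in_open_cone:
  fixes U :: "(real^'n) set"
  assumes U: "open U" "U \<noteq> {}" and scale: "\<And>x r. x \<in> U \<Longrightarrow> 0 < r \<Longrightarrow> r *\<^sub>R x \<in> U"
  obtains a where "int_vec a \<in> U"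
proof -
  let ?D = "\<Union>k. \<Union>f \<in> Basis \<rightarrow> \<int>. {\<Sum>i::real^'n\<in>Basis. (f i / 2 ^ k) *\<^sub>R i}"
  have "U \<inter> ?D \<noteq> {}"
    using open_Int_closure_eq_empty[OF U(1), of ?D] closure_dyadic_rationals U(2) by auto
  then obtain k f where f: "f \<in> Basis \<rightarrow> \<int>" and fU: "(\<Sum>i::real^'n\<in>Basis. (f i / 2 ^ k) *\<^sub>R i) \<in> U"
    by auto
  define x where "x = (\<Sum>i::real^'n\<in>Basis. f i *\<^sub>R i)"
  have "2 ^ k *\<^sub>R (\<Sum>i::real^'n\<in>Basis. (f i / 2 ^ k) *\<^sub>R i) = x"
    by (simp add: x_def scaleR_sum_right)
  then have xU: "x \<in> U" using scale[OF fU, of "2 ^ k"] by simp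
  have "x $ i \<in> \<int>" for i
  proof -
    have "x $ i = x \<bullet> axis i 1" by (simp add: inner_axis)
    also have "\<dots> = f (axis i 1)" unfolding x_def by (rule inner_sum_left_Basis) (simp add: axis_in_Basis_iff)
    also have "\<dots> \<in> \<int>" using f by (auto simp: axis_in_Basis_iff)
    finally show ?thesis .
  qed
  then have "int_vec (\<chi> i. \<lfloor>x $ i\<rfloor>) = x"
    by (simp add: int_vec_def vec_eq_iff)
  with xU that show ?thesis by metis
qed

text \<open>
If \<open>v \<notin> \<sigma>\<close>, some real \<open>a\<close> in the dual cone is negative on \<open>v\<close>, but it may be irrational. Adding a
small multiple of a vector \<open>u\<close> that is positive on all nonzero generators moves \<open>a\<close> into the interior
of the dual cone, where integer vectors can be found.
\<close>

lemma mem_cone_iff_dual_semigroup: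
  fixes \<sigma> :: "(real^'n) set"
  assumes rat: "rational_polyhedral_cone \<sigma>" and strong: "strongly_convex \<sigma>"
  shows "v \<in> \<sigma> \<longleftrightarrow> (\<forall>a\<in>dual_semigroup \<sigma>. 0 \<le> v \<bullet> int_vec a)"
proof
  show "v \<in> \<sigma> \<Longrightarrow> \<forall>a\<in>dual_semigroup \<sigma>. 0 \<le> v \<bullet> int_vec a"
    by (simp add: dual_semigroup_def dual_cone_def)
next
  assume v: "\<forall>a\<in>dual_semigroup \<sigma>. 0 \<le> v \<bullet> int_vec a"
  obtain T :: "(int^'n) set" where T: "finite T" "\<sigma> = convex_cone hull (int_vec ` T)"
    using rat by (auto simp: rational_polyhedral_cone_def)
  let ?S = "int_vec ` T"
  have fin: "finite ?S" using T(1) by simp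
  have cone: "convex_cone \<sigma>" unfolding T(2) by (rule convex_cone_convex_cone_hull)
  show "v \<in> \<sigma>"
  proof (rule ccontr)
    assume "v \<notin> \<sigma>"
    then obtain a b where ab: "a \<bullet> v < b" "\<And>x. x \<in> \<sigma> \<Longrightarrow> b < a \<bullet> x"
      using separating_hyperplane_closed_point[of \<sigma> v] closed_convex_cone_hull[OF fin]
        convex_convex_cone_hull[of ?S] unfolding T(2) by blast
    have "b < 0" using ab(2)[OF convex_cone_contains_0[OF cone]] by simp
    with ab(1) have av: "a \<bullet> v < 0" by simp
    have a_nonneg: "0 \<le> a \<bullet> x" if x: "x \<in> \<sigma>" for x
    proof (rule ccontr)
      assume "\<not> 0 \<le> a \<bullet> x"
      then have neg: "a \<bullet> x < 0" by simp
      have "b < a \<bullet> ((b / (a \<bullet> x)) *\<^sub>R x)"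
        using neg \<open>b < 0\<close> x by (intro ab(2) convex_cone_scaleR[OF cone]) (auto simp: divide_nonpos_neg)
      with neg show False by simp
    qed
    obtain u where u: "\<And>s. s \<in> ?S \<Longrightarrow> s \<noteq> 0 \<Longrightarrow> 0 < u \<bullet> s"
      using strongly_convex_ex_positive[OF fin] strong T(2) by blast
    define U where "U = {y. y \<bullet> v < 0} \<inter> (\<Inter>s\<in>?S - {0}. {y. 0 < y \<bullet> s})"
    have "open U"
      unfolding U_def using fin
      by (intro open_Int open_INT ballI) (auto intro!: open_Collect_less continuous_intros)
    moreover have "U \<noteq> {}"
    proof -
      have "((\<lambda>\<delta>. (a + \<delta> *\<^sub>R u) \<bullet> v) \<longlongrightarrow> (a + 0 *\<^sub>R u) \<bullet> v) (at_right 0)"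
        by (intro tendsto_intros)
      then have "eventually (\<lambda>\<delta>. (a + \<delta> *\<^sub>R u) \<bullet> v < 0) (at_right 0)"
        using av by (intro order_tendstoD(2)) auto
      moreover have "eventually (\<lambda>\<delta>. \<delta> > (0::real)) (at_right 0)" by (rule eventually_at_right_less)
      ultimately have "eventually (\<lambda>\<delta>. a + \<delta> *\<^sub>R u \<in> U) (at_right 0)"
      proof eventually_elim
        case (elim \<delta>)
        have "0 < (a + \<delta> *\<^sub>R u) \<bullet> s" if "s \<in> ?S - {0}" for s
          using that elim(2) u[of s] a_nonneg[of s] hull_inc[of s ?S convex_cone] T(2)
          by (simp add: inner_add_left add_nonneg_pos)
        with elim(1) show ?case by (simp add: U_def)
      qed
      then show ?thesis using eventually_happens[of _ "at_right (0::real)"] by (auto simp: trivial_limit_at_right_real)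
    qed
    moreover have "r *\<^sub>R x \<in> U" if "x \<in> U" "0 < r" for x r
      using that by (auto simp: U_def mult_pos_neg)
    ultimately obtain c where c: "int_vec c \<in> U" using ex_integer_vector_in_open_cone by blast
    have "\<sigma> \<subseteq> {x. 0 \<le> int_vec c \<bullet> x}"
      unfolding T(2)
    proof (rule hull_minimal)
      show "?S \<subseteq> {x. 0 \<le> int_vec c \<bullet> x}"
      proof
        fix s assume "s \<in> ?S"
        then show "s \<in> {x. 0 \<le> int_vec c \<bullet> x}"
          using c by (cases "s = 0") (auto simp: U_def intro: less_imp_le)
      qed
    qed (rule convex_cone_halfspace_ge)
    then have "c \<in> dual_semigroup \<sigma>"
      by (auto simp: dual_semigroup_def dual_cone_def inner_commute)
    with v have "0 \<le> v \<bullet> int_vec c" by blast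
    moreover have "int_vec c \<bullet> v < 0" using c by (simp add: U_def)
    ultimately show False by (simp add: inner_commute)
  qed
qed

lemma nonneg_orthant_eq: "nonneg_orthant = (\<Inter>i. {\<omega> :: real^'s. 0 \<le> axis i 1 \<bullet> \<omega>})"
  by (simp add: nonneg_orthant_def inner_axis' set_eq_iff)

lemma polyhedron_nonneg_orthant: "polyhedron (nonneg_orthant :: (real^'s) set)"
proof -
  have "polyhedron {\<omega> :: real^'s. 0 \<le> axis i 1 \<bullet> \<omega>}" for i
    by (rule polyhedron_halfspace_ge)
  then show ?thesis unfolding nonneg_orthant_eq by (intro polyhedron_Inter) (simp_all add: image_iff, blast)
qed

lemma convex_cone_nonneg_orthant: "convex_cone (nonneg_orthant :: (real^'s) set)"
  by (simp add: nonneg_orthant_def convex_cone_iff)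

context
  fixes \<sigma> :: "(real^'n) set" and \<alpha> :: "'s::finite \<Rightarrow> int^'n"
  assumes rat: "rational_polyhedral_cone \<sigma>" and strong: "strongly_convex \<sigma>"
    and gen: "dual_semigroup \<sigma> = range (exponent_map \<alpha>)"
begin

lemma mem_cone_iff_phi: "v \<in> \<sigma> \<longleftrightarrow> phi \<alpha> v \<in> nonneg_orthant"
proof
  assume "v \<in> \<sigma>"
  moreover have "\<alpha> i \<in> dual_semigroup \<sigma>" for i unfolding gen by (metis exponent_map_axis rangeI)
  ultimately show "phi \<alpha> v \<in> nonneg_orthant"
    by (simp add: nonneg_orthant_def phi_def dual_semigroup_def dual_cone_def)
next
  assume v: "phi \<alpha> v \<in> nonneg_orthant"
  have "0 \<le> v \<bullet> int_vec (exponent_map \<alpha> c)" for c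
  proof -
    have "0 \<le> phi \<alpha> v \<bullet> nat_vec c"
      unfolding inner_vec_def using v by (intro sum_nonneg) (simp add: nonneg_orthant_def nat_vec_def)
    then show ?thesis by (simp only: phi_inner_nat_vec)
  qed
  then show "v \<in> \<sigma>" by (simp add: mem_cone_iff_dual_semigroup[OF rat strong] gen)
qed

text \<open>
A real point \<open>v\<close> with \<open>v \<bullet> \<alpha> i \<ge> 0\<close> for all generators lies in \<open>\<sigma>\<close>, so the coordinate inequalities of
the orthant are precisely those of the cone.
\<close>

lemma phi_image_cone: "phi \<alpha> ` \<sigma> = nonneg_orthant \<inter> range (phi \<alpha>)"
  by (auto simp: mem_cone_iff_phi)

lemma inj_phi: "inj (phi \<alpha>)"
proof -
  have "v = 0" if "phi \<alpha> v = 0" for v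
  proof -
    have "phi \<alpha> (- v) = 0" using that linear_neg[OF linear_phi, of \<alpha> v] by simp
    with that have "v \<in> \<sigma>" "- v \<in> \<sigma>" by (simp_all add: mem_cone_iff_phi nonneg_orthant_def)
    then have "v \<in> \<sigma> \<inter> uminus ` \<sigma>" using image_eqI[of v uminus "- v" \<sigma>] by simp
    then show "v = 0" using strong unfolding strongly_convex_def by blast
  qed
  then show ?thesis using linear_injective_0[OF linear_phi] by blast
qed

end

theorem theorem3p5:
  fixes \<sigma> :: "(real^'n) set"
    and \<alpha> :: "'s::finite \<Rightarrow> int^'n"
    and I :: "(int^'n \<Rightarrow>\<^sub>0 'k::field) set"
    and J :: "(nat^'s \<Rightarrow>\<^sub>0 'k) set"
  assumes "perfect_field TYPE('k)"
    and "rational_polyhedral_cone \<sigma>" and "strongly_convex \<sigma>" and "dim \<sigma> = CARD('n)"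
    and "inj \<alpha>" and "minimal_generators (range \<alpha>) (dual_semigroup \<sigma>)"
    and "ideal I (semigroup_ring (dual_semigroup \<sigma>))"
    and "J = Psi \<alpha> -` I"
  shows "(\<forall>v\<in>\<sigma>. \<forall>v'\<in>\<sigma>.
            In_toric \<sigma> v I = In_toric \<sigma> v' I \<longleftrightarrow>
            In_poly (phi \<alpha> v) J = In_poly (phi \<alpha> v') J) \<and>
         (polyhedral_fan (groebner_fan J) \<longrightarrow>
            subdivision_of (toric_groebner_fan \<sigma> I) \<sigma> \<and>
            image (phi \<alpha>) ` toric_groebner_fan \<sigma> I =
              (\<lambda>\<tau>. \<tau> \<inter> phi \<alpha> ` \<sigma>) ` groebner_fan J)"
proof -
  note rat = assms(2) and strong = assms(3)
  have gen: "dual_semigroup \<sigma> = range (exponent_map \<alpha>)"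
    using assms(6) by (simp add: minimal_generators_def range_exponent_map)
  then have I: "semigroup_ideal (dual_semigroup \<sigma>) I"
    using assms(7) ideal_semigroup_ring_iff submonoid_set_range_exponent_map by metis
  have J: "semigroup_ideal UNIV J"
    unfolding assms(8) using gen I by (rule semigroup_ideal_Psi_vimage)
  have initial: "In_toric \<sigma> v I = In_toric \<sigma> v' I \<longleftrightarrow> In_poly (phi \<alpha> v) J = In_poly (phi \<alpha> v') J"
    for v v' unfolding assms(8) by (rule In_toric_eq_iff[OF gen I])
  let ?X = "nonneg_orthant :: (real^'s) set"
  note image = phi_image_cone[OF rat strong gen] and inj = inj_phi[OF rat strong gen]
  have "subdivision_of (toric_groebner_fan \<sigma> I) \<sigma> \<and>
      image (phi \<alpha>) ` toric_groebner_fan \<sigma> I = (\<lambda>\<tau>. \<tau> \<inter> phi \<alpha> ` \<sigma>) ` groebner_fan J"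
    if fan: "polyhedral_fan (groebner_fan J)"
  proof -
    interpret homogeneous_class_fan "\<lambda>\<omega>. In_poly \<omega> J" ?X "range (phi \<alpha>)"
      "\<lambda>\<omega>. homogeneity_space (In_poly \<omega> J)"
    proof
      show "polyhedron ?X" "convex_cone ?X"
        by (rule polyhedron_nonneg_orthant convex_cone_nonneg_orthant)+
      show "subspace (range (phi \<alpha>))"
        by (rule linear_subspace_image[OF linear_phi subspace_UNIV])
      show "polyhedral_fan (class_fan (\<lambda>\<omega>. In_poly \<omega> J) ?X)"
        using fan by (simp add: groebner_fan_def)
      show "subspace (homogeneity_space (In_poly x J))" for x
        by (rule subspace_homogeneity_space[OF semigroup_ideal_In_poly[OF J]])
      show "y \<in> homogeneity_space (In_poly x J)" if "In_poly y J = In_poly x J" for x y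
        using weight_in_homogeneity_space[OF J, of y] that by simp
      show "eventually (\<lambda>\<epsilon>. In_poly (x + \<epsilon> *\<^sub>R u) J = In_poly x J) (at_right 0)"
        if "u \<in> homogeneity_space (In_poly x J)" for x u
        using In_poly_locally_constant[OF J that] .
    qed
    have slice: "image (phi \<alpha>) ` toric_groebner_fan \<sigma> I =
        class_fan (\<lambda>\<omega>. In_poly \<omega> J) (?X \<inter> range (phi \<alpha>))"
      unfolding toric_groebner_fan_def image[symmetric]
      using class_fan_linear_image[OF linear_phi inj, of \<sigma> "\<lambda>v. In_toric \<sigma> v I" "\<lambda>\<omega>. In_poly \<omega> J"] initial
      by simp
    have "polyhedral_fan (image (phi \<alpha>) ` toric_groebner_fan \<sigma> I)"
      unfolding slice by (rule polyhedral_fan_slice)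
    then have "polyhedral_fan (toric_groebner_fan \<sigma> I)"
      by (rule polyhedral_fan_linear_image[OF linear_phi inj])
    moreover have "\<Union>(toric_groebner_fan \<sigma> I) = \<sigma>"
      unfolding toric_groebner_fan_def
      using rat closed_convex_cone_hull by (intro Union_class_fan) (auto simp: rational_polyhedral_cone_def)
    moreover have "image (phi \<alpha>) ` toric_groebner_fan \<sigma> I = (\<lambda>\<tau>. \<tau> \<inter> phi \<alpha> ` \<sigma>) ` groebner_fan J"
      unfolding slice class_fan_slice image groebner_fan_def ..
    ultimately show ?thesis by (simp add: subdivision_of_def)
  qed
  then show ?thesis
    by (intro conjI ballI impI initial) auto
qed

end
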